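(* Let $d\ge1$ and $k\ge0$ be integers. The map sending a maximal chain $\mathbf{m}=\{\hat0=\pi_0\prec\pi_1\prec\cdots\prec\pi_k=\hat1\}$ of $\mathrm{NC}^{d}_{dk+1}$ to its list of labels $\lambda(\mathbf{m})=(\lambda(\pi_0,\pi_1),\dots,\lambda(\pi_{k-1},\pi_k))$ is a bijection between the set of all maximal chains of $\mathrm{NC}^{d}_{dk+1}$ and the set of all $d$-parking functions of length $k$.
   Context: A partition of $[n]$ is noncrossing if there are no $i<j<k<\ell$ with $i,k$ in one block and $j,\ell$ in a different block. The Kreweras dual $\pi'$ of a noncrossing partition $\pi$ of $[n]$: place $1,1',2,2',\dots,n,n'$ on a circle in this cyclic order; $\pi'$ is the coarsest partition of $\{1',\dots,n'\}$ such that the blocks of $\pi$ and of $\pi'$ together form a noncrossing partition of these $2n$ points. $\mathrm{NC}^d_n$ is the poset, ordered by refinement, of noncrossing partitions $\pi$ of $[n]$ such that every block of $\pi$ and every block of $\pi'$ has cardinality congruent to $1$ modulo $d$. In this poset every cover relation $\pi\prec\sigma$ arises by merging exactly $d+1$ blocks $B_1,\dots,B_{d+1}$ of $\pi$, indexed so that $\min B_1<\min B_2<\cdots<\min B_{d+1}$; the edge label is $\lambda(\pi,\sigma)=\max\{i\in B_1 : i<\min B_2\}$. A $d$-parking function of length $k$ is a list $(a_1,\dots,a_k)$ of positive integers whose nondecreasing rearrangement $a_{(1)}\le\cdots\le a_{(k)}$ satisfies $a_{(i)}\le d(i-1)+1$ for all $i$. *)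

theory Defs
  imports Complex_Main "HOL-Library.Disjoint_Sets" "HOL-Number_Theory.Cong"
begin

definition noncrossing :: "nat set set \<Rightarrow> bool" where
  "noncrossing P \<longleftrightarrow>
     \<not> (\<exists>A\<in>P. \<exists>B\<in>P. A \<noteq> B \<and>
         (\<exists>i j k l. i < j \<and> j < k \<and> k < l \<and> i \<in> A \<and> k \<in> A \<and> j \<in> B \<and> l \<in> B))"

definition noncrossing_partition :: "nat \<Rightarrow> nat set set \<Rightarrow> bool" where
  "noncrossing_partition n P \<longleftrightarrow> partition_on {1..n} P \<and> noncrossing P"

(* The 2n points 1, 1', 2, 2', ..., n, n' are encoded as the integers 2, 3, ..., 2n+1,
   with i encoded as 2i and i' as 2i+1.  Being noncrossing is invariant under cyclic shift,
   so the circle may be cut open between n' and 1. *)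
definition interleave :: "nat set set \<Rightarrow> nat set set \<Rightarrow> nat set set" where
  "interleave P Q = (\<lambda>B. (\<lambda>i. 2 * i) ` B) ` P \<union> (\<lambda>B. (\<lambda>i. 2 * i + 1) ` B) ` Q"

(* A partition of {1', ..., n'} is represented by the corresponding partition of {1..n}. *)
definition kreweras_compatible :: "nat \<Rightarrow> nat set set \<Rightarrow> nat set set \<Rightarrow> bool" where
  "kreweras_compatible n P Q \<longleftrightarrow> partition_on {1..n} Q \<and> noncrossing (interleave P Q)"

definition kreweras_dual :: "nat \<Rightarrow> nat set set \<Rightarrow> nat set set" where
  "kreweras_dual n P =
     (THE Q. kreweras_compatible n P Q \<and>
             (\<forall>R. kreweras_compatible n P R \<longrightarrow> refines {1..n} R Q))"

definition NC :: "nat \<Rightarrow> nat \<Rightarrow> nat set set set" where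
  "NC d n = {P. noncrossing_partition n P \<and>
                (\<forall>B\<in>P. [card B = 1] (mod d)) \<and>
                (\<forall>B\<in>kreweras_dual n P. [card B = 1] (mod d))}"

definition strictly_refines :: "nat \<Rightarrow> nat set set \<Rightarrow> nat set set \<Rightarrow> bool" where
  "strictly_refines n P Q \<longleftrightarrow> refines {1..n} P Q \<and> P \<noteq> Q"

definition maximal_chains :: "nat \<Rightarrow> nat \<Rightarrow> nat set set set set" where
  "maximal_chains d n = {C. pred_on.maxchain (NC d n) (strictly_refines n) C}"

(* If Q covers P, then P - Q consists of exactly the blocks B_1, ..., B_(d+1) of P that are
   merged into a single block of Q; the list bs enumerates them by increasing minimum. *)
definition edge_label :: "nat set set \<Rightarrow> nat set set \<Rightarrow> nat" where
  "edge_label P Q =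
     (let bs = sorted_key_list_of_set Min (P - Q)
      in Max {i \<in> bs ! 0. i < Min (bs ! 1)})"

definition chain_list :: "nat \<Rightarrow> nat set set set \<Rightarrow> nat set set list" where
  "chain_list n C = (THE ps. set ps = C \<and> sorted_wrt (strictly_refines n) ps)"

definition chain_labels :: "nat \<Rightarrow> nat set set set \<Rightarrow> nat list" where
  "chain_labels n C = (let ps = chain_list n C in map2 edge_label ps (tl ps))"

(* The index i below starts at 0, so the paper's bound d(i-1)+1 reads d*i+1. *)
definition parking_functions :: "nat \<Rightarrow> nat \<Rightarrow> nat list set" where
  "parking_functions d k =
     {a. length a = k \<and> (\<forall>x\<in>set a. 0 < x) \<and> (\<forall>i<k. sort a ! i \<le> d * i + 1)}"

end

(* A partition with all block sizes congruent to 1 mod d also has all dual block sizes congruent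
   to 1 mod d iff in each block the j-th smallest element is congruent to Min + j mod d. This
   condition refers to each block separately, so a cover relation concerns a single block B: it is
   given by points x_0 < ... < x_d of B, which cut off the pieces of B in (x_i, x_(i+1)] and leave
   the piece of B outside (x_0, x_d]; its label is x_0.

   Given the labels, a maximal chain is recovered from the top. Call a list parked on B if the walk
   along B with steps d * multiplicity - 1 first hits -1 at the last element of B. For {1..dk+1} this
   says that the list is a d-parking function. If as @ [a] is parked on B and a is in B, then
   exactly one cover below B with label a has only pieces on which as is parked: x_(i+1) is the
   first passage of the walk of as one level below its value at x_i. Conversely, concatenating
   walks shows that as @ [x_0] is parked on B whenever as is parked on all pieces. *)

theory Submission
  imports Defs
begin

section \<open>Kreweras duals\<close>

text \<open>The obstacle is that the dual is defined by a maximality property of the whole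
  partition, whereas covers are to be studied inside one block. The way out is to read the point
  \<open>i'\<close> as the gap after \<open>i\<close>. For neighbours \<open>a < b\<close> of a
  block, the dual block of the gap after \<open>a\<close> consists of that gap and the ends of the
  outermost blocks nested between \<open>a\<close> and \<open>b\<close>. Once the hulls of these
  nested blocks have length congruent to 1, the dual block has size congruent to
  \<open>b - a\<close>, so dual sizes turn into congruences between neighbours.

  That covers in a maximal chain are splits, and that split chains are maximal, both rest on one
  fact: if \<open>R\<close> properly refines \<open>Q\<close>, then some split of \<open>Q\<close>
  is still refined by \<open>R\<close>. A split changes the number of blocks by exactly
  \<open>d\<close>, so this number serves as a rank.

  The walk argument works because down steps have size 1: no level is skipped on the way down, so
  pieces can be cut off at successive levels. The label appended last lifts the walk by
  \<open>d\<close> at \<open>x_0\<close>, which pays for exactly the \<open>d\<close> levels lost on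
  the interval pieces.\<close>

lemma partition_on_memD:
  "partition_on S P \<Longrightarrow> B \<in> P \<Longrightarrow> B \<subseteq> S \<and> B \<noteq> {}"
  unfolding partition_on_def by blast

lemma partition_on_block_eq:
  "partition_on S P \<Longrightarrow> B \<in> P \<Longrightarrow> C \<in> P \<Longrightarrow> x \<in> B \<Longrightarrow> x \<in> C \<Longrightarrow> B = C"
  unfolding partition_on_def disjoint_def by blast

lemma partition_on_obtain:
  assumes "partition_on S P" "x \<in> S"
  obtains B where "B \<in> P" "x \<in> B"
  using assms unfolding partition_on_def by blast

lemma noncrossingD:
  "noncrossing P \<Longrightarrow> A \<in> P \<Longrightarrow> B \<in> P \<Longrightarrow> i < j \<Longrightarrow> j < k \<Longrightarrow> k < l \<Longrightarrow>
    i \<in> A \<Longrightarrow> k \<in> A \<Longrightarrow> j \<in> B \<Longrightarrow> l \<in> B \<Longrightarrow> A = B"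
  unfolding noncrossing_def by meson

lemma noncrossingI:
  assumes "\<And>A B i j k l. A \<in> P \<Longrightarrow> B \<in> P \<Longrightarrow> i < j \<Longrightarrow> j < k \<Longrightarrow> k < l \<Longrightarrow>
    i \<in> A \<Longrightarrow> k \<in> A \<Longrightarrow> j \<in> B \<Longrightarrow> l \<in> B \<Longrightarrow> A = B"
  shows "noncrossing P"
  unfolding noncrossing_def using assms by blast

text \<open>The gap after \<open>i\<close> separates two points of a block if exactly one of them is at most \<open>i\<close>.
  Two gaps lie in the same block of the Kreweras dual iff they separate the same pairs.\<close>

definition same_gap :: "nat set set \<Rightarrow> nat \<Rightarrow> nat \<Rightarrow> bool" where
  "same_gap P i j \<longleftrightarrow> (\<forall>B\<in>P. \<forall>b\<in>B. \<forall>c\<in>B. ((b \<le> i) = (c \<le> i)) = ((b \<le> j) = (c \<le> j)))"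

definition gap_class :: "nat \<Rightarrow> nat set set \<Rightarrow> nat \<Rightarrow> nat set" where
  "gap_class n P i = {y \<in> {1..n}. same_gap P i y}"

lemma same_gap_refl [simp]: "same_gap P i i"
  unfolding same_gap_def by blast

lemma same_gap_sym: "same_gap P i j \<Longrightarrow> same_gap P j i"
  unfolding same_gap_def by blast

lemma same_gap_trans: "same_gap P i j \<Longrightarrow> same_gap P j k \<Longrightarrow> same_gap P i k"
  unfolding same_gap_def by simp

lemma same_gapD:
  "same_gap P i j \<Longrightarrow> B \<in> P \<Longrightarrow> b \<in> B \<Longrightarrow> c \<in> B \<Longrightarrow> ((b \<le> i) = (c \<le> i)) = ((b \<le> j) = (c \<le> j))"
  unfolding same_gap_def by blast

lemma gap_class_cong: "same_gap P i j \<Longrightarrow> gap_class n P i = gap_class n P j"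
  unfolding gap_class_def using same_gap_sym same_gap_trans by blast

lemma partition_on_gap_classes: "partition_on {1..n} (gap_class n P ` {1..n})"
proof (rule partition_onI)
  show "\<Union> (gap_class n P ` {1..n}) = {1..n}"
    unfolding gap_class_def by auto
next
  fix p q assume "p \<in> gap_class n P ` {1..n}" "q \<in> gap_class n P ` {1..n}" "p \<noteq> q"
  then obtain i j where ij: "p = gap_class n P i" "q = gap_class n P j" "p \<noteq> q" by blast
  show "disjnt p q"
  proof (rule ccontr)
    assume "\<not> disjnt p q"
    then obtain y where "same_gap P i y" "same_gap P j y"
      using ij unfolding disjnt_def gap_class_def by blast
    then have "same_gap P i j" using same_gap_sym same_gap_trans by blast
    then show False using ij gap_class_cong by blast
  qed
next
  show "{} \<notin> gap_class n P ` {1..n}"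
    unfolding gap_class_def using same_gap_refl by fastforce
qed

text \<open>A crossing of a block with a class would put into one class a gap that separates some
  pair of the block and a gap that does not. Two crossing classes are forced to coincide.\<close>

lemma gap_classes_compatible:
  assumes P: "partition_on {1..n} P" "noncrossing P"
  shows "kreweras_compatible n P (gap_class n P ` {1..n})"
  unfolding kreweras_compatible_def
proof (intro conjI noncrossingI)
  show "partition_on {1..n} (gap_class n P ` {1..n})" by (rule partition_on_gap_classes)
next
  let ?Q = "gap_class n P ` {1..n}"
  have sep: False
    if "B \<in> P" "D \<in> ?Q" "b \<in> B" "c \<in> B" "y \<in> D" "z \<in> D"
      "(b \<le> y) = (c \<le> y)" "(b \<le> z) \<noteq> (c \<le> z)" for B D b c y z
  proof -
    have "same_gap P y z"
      using that(2,5,6) same_gap_sym same_gap_trans unfolding gap_class_def by blast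
    from same_gapD[OF this that(1,3,4)] that(7,8) show False by blast
  qed
  fix A B and i j k l :: nat
  assume A: "A \<in> interleave P ?Q" and B: "B \<in> interleave P ?Q"
    and ijkl: "i < j" "j < k" "k < l" "i \<in> A" "k \<in> A" "j \<in> B" "l \<in> B"
  from A consider A0 where "A0 \<in> P" "A = (\<lambda>i. 2 * i) ` A0" | A0 where "A0 \<in> ?Q" "A = (\<lambda>i. 2 * i + 1) ` A0"
    unfolding interleave_def by blast
  note cA = this
  from B consider B0 where "B0 \<in> P" "B = (\<lambda>i. 2 * i) ` B0" | B0 where "B0 \<in> ?Q" "B = (\<lambda>i. 2 * i + 1) ` B0"
    unfolding interleave_def by blast
  note cB = this
  from cA show "A = B"
  proof cases
    case (1 A0)
    note A0 = this
    obtain i' k' where ik: "i = 2 * i'" "k = 2 * k'" "i' \<in> A0" "k' \<in> A0" using A0 ijkl by blast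
    from cB show ?thesis
    proof cases
      case (1 B0)
      obtain j' l' where jl: "j = 2 * j'" "l = 2 * l'" "j' \<in> B0" "l' \<in> B0" using 1 ijkl by blast
      have "i' < j'" "j' < k'" "k' < l'" using ik jl ijkl by auto
      with noncrossingD[OF P(2) A0(1) 1(1)] ik jl have "A0 = B0" by blast
      then show ?thesis using A0 1 by blast
    next
      case (2 B0)
      obtain j' l' where jl: "j = 2 * j' + 1" "l = 2 * l' + 1" "j' \<in> B0" "l' \<in> B0" using 2 ijkl by blast
      have "i' \<le> j'" "\<not> k' \<le> j'" "k' \<le> l'" "i' \<le> l'" using ik jl ijkl by auto
      then show ?thesis using sep[OF A0(1) 2(1) ik(3,4) jl(4,3)] by blast
    qed
  next
    case (2 A0)
    note A0 = this
    obtain i' k' where ik: "i = 2 * i' + 1" "k = 2 * k' + 1" "i' \<in> A0" "k' \<in> A0" using A0 ijkl by blast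
    from cB show ?thesis
    proof cases
      case (1 B0)
      obtain j' l' where jl: "j = 2 * j'" "l = 2 * l'" "j' \<in> B0" "l' \<in> B0" using 1 ijkl by blast
      have "\<not> j' \<le> i'" "j' \<le> k'" "\<not> l' \<le> k'" "\<not> l' \<le> i'" using ik jl ijkl by auto
      then show ?thesis using sep[OF 1(1) A0(1) jl(3,4) ik(3,4)] by blast
    next
      case (2 B0)
      obtain j' l' where jl: "j = 2 * j' + 1" "l = 2 * l' + 1" "j' \<in> B0" "l' \<in> B0" using 2 ijkl by blast
      have less: "i' < j'" "j' < k'" "k' < l'" using ik jl ijkl by auto
      have g: "same_gap P i' k'" "same_gap P j' l'"
        using A0(1) 2(1) ik(3,4) jl(3,4) same_gap_sym same_gap_trans unfolding gap_class_def by blast+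
      \<comment> \<open>A pair separated by gap \<open>j'\<close> is also separated by
        \<open>l'\<close>, so it straddles \<open>k'\<close>, which lies in between; a pair
        separated by \<open>k'\<close> is also separated by \<open>i'\<close>, so it straddles
        \<open>j'\<close>.\<close>
      have "same_gap P j' k'"
        unfolding same_gap_def
      proof (intro ballI)
        fix C b c assume "C \<in> P" "b \<in> C" "c \<in> C"
        then show "((b \<le> j') = (c \<le> j')) = ((b \<le> k') = (c \<le> k'))"
          using g[THEN same_gapD, of C b c] less by linarith
      qed
      moreover have "X = gap_class n P x" if "X \<in> ?Q" "x \<in> X" for X x
        using that gap_class_cong unfolding gap_class_def by blast
      then have "A0 = gap_class n P k'" "B0 = gap_class n P j'" using A0 2 ik jl by blast+
      ultimately show ?thesis using A0 2 gap_class_cong by metis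
    qed
  qed
qed

text \<open>Gaps \<open>y < z\<close> are inequivalent exactly when some block has one point in
  \<open>{y<..z}\<close> and another outside. In the parity encoding such a block crosses any dual
  block containing both gaps.\<close>

lemma compatible_refines_gap_classes:
  assumes P: "partition_on {1..n} P" and R: "kreweras_compatible n P R"
  shows "refines {1..n} R (gap_class n P ` {1..n})"
  unfolding refines_def
proof (intro conjI ballI)
  have Rp: "partition_on {1..n} R" and nc: "noncrossing (interleave P R)"
    using R unfolding kreweras_compatible_def by auto
  show "partition_on {1..n} R" by (fact Rp)
  show "partition_on {1..n} (gap_class n P ` {1..n})" by (rule partition_on_gap_classes)
  fix X assume X: "X \<in> R"
  have no: False if "B \<in> P" "b \<in> B" "c \<in> B" "y \<in> X" "z \<in> X"
     "y < b" "b \<le> z" "c \<le> y \<or> z < c" for B b c y z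
  proof -
    let ?B = "(\<lambda>i. 2 * i) ` B" and ?X = "(\<lambda>i. 2 * i + 1) ` X"
    have mem: "?B \<in> interleave P R" "?X \<in> interleave P R"
      using that(1) X unfolding interleave_def by auto
    have in1: "2 * b \<in> ?B" "2 * c \<in> ?B" "2 * y + 1 \<in> ?X" "2 * z + 1 \<in> ?X" using that by auto
    have ne: "?B \<noteq> ?X"
    proof
      assume "?B = ?X"
      then have "2 * b \<in> ?X" using in1 by blast
      then show False by (auto; presburger)
    qed
    from that(8) show False
    proof
      assume "c \<le> y"
      then show False using noncrossingD[OF nc mem, of "2*c" "2*y+1" "2*b" "2*z+1"] in1 ne that(6,7)
        by simp
    next
      assume "z < c"
      then show False using noncrossingD[OF nc mem(2,1), of "2*y+1" "2*b" "2*z+1" "2*c"] in1 ne that(6,7)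
        by simp
    qed
  qed
  have sg: "same_gap P y z" if "y \<in> X" "z \<in> X" "y < z" for y z
    unfolding same_gap_def
  proof (intro ballI)
    fix B b c assume "B \<in> P" "b \<in> B" "c \<in> B"
    with no[of B b c y z] no[of B c b y z] that
    show "((b \<le> y) = (c \<le> y)) = ((b \<le> z) = (c \<le> z))"
      by (cases "b \<le> y"; cases "c \<le> y"; cases "b \<le> z"; cases "c \<le> z") auto
  qed
  have X': "X \<subseteq> {1..n}" "X \<noteq> {}" using partition_on_memD[OF Rp X] by auto
  then obtain y where y: "y \<in> X" by blast
  have "X \<subseteq> gap_class n P y"
  proof
    fix z assume "z \<in> X"
    then show "z \<in> gap_class n P y"
      using sg[of y z] sg[of z y] same_gap_sym y X' unfolding gap_class_def
      by (cases y z rule: linorder_cases) auto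
  qed
  then show "\<exists>Y\<in>gap_class n P ` {1..n}. X \<subseteq> Y" using y X' by blast
qed

text \<open>Antisymmetry of refinement makes the coarsest compatible partition unique. This replaces
  the definite description by explicit sets that can be counted.\<close>

lemma kreweras_dual_eq:
  assumes "noncrossing_partition n P"
  shows "kreweras_dual n P = gap_class n P ` {1..n}"
  unfolding kreweras_dual_def
proof (rule the_equality)
  have P: "partition_on {1..n} P" "noncrossing P" using assms unfolding noncrossing_partition_def by auto
  show 1: "kreweras_compatible n P (gap_class n P ` {1..n}) \<and>
    (\<forall>R. kreweras_compatible n P R \<longrightarrow> refines {1..n} R (gap_class n P ` {1..n}))"
    using gap_classes_compatible[OF P] compatible_refines_gap_classes[OF P(1)] by blast
  fix Q assume "kreweras_compatible n P Q \<and> (\<forall>R. kreweras_compatible n P R \<longrightarrow> refines {1..n} R Q)"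
  with 1 show "Q = gap_class n P ` {1..n}" using refines_asym by blast
qed

section \<open>Dual block sizes as congruences inside single blocks\<close>

lemma cong_Suc_iff: "[Suc a = Suc b] (mod d) \<longleftrightarrow> [a = b] (mod d)"
  using cong_add_rcancel_nat[of a 1 b d] by simp

text \<open>The condition is stated for all pairs, not relative to the minimum: no enumeration of
  \<open>B\<close> is needed, and it passes directly to convex parts of \<open>B\<close>.\<close>

definition good :: "nat \<Rightarrow> nat set \<Rightarrow> bool" where
  "good d B \<longleftrightarrow> [card B = 1] (mod d) \<and>
     (\<forall>x\<in>B. \<forall>y\<in>B. x \<le> y \<longrightarrow> [y = x + card (B \<inter> {x..<y})] (mod d))"

lemma goodD: "good d B \<Longrightarrow> x \<in> B \<Longrightarrow> y \<in> B \<Longrightarrow> x \<le> y \<Longrightarrow> [y = x + card (B \<inter> {x..<y})] (mod d)"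
  unfolding good_def by blast

text \<open>The elements other than the maximum are a multiple of \<open>d\<close> in number. Hence
  the hull of a good block has length congruent to 1, which is all that an enclosing block has to
  know about it.\<close>

lemma good_Max_Min:
  assumes "good d B" "finite B" "B \<noteq> {}"
  shows "[Max B = Min B] (mod d)"
proof -
  have "[Max B = Min B + card (B \<inter> {Min B..<Max B})] (mod d)"
    using assms by (intro goodD) auto
  moreover have "B \<inter> {Min B..<Max B} = B - {Max B}"
    using assms by (auto simp: order.not_eq_order_implies_strict)
  then have "Suc (card (B \<inter> {Min B..<Max B})) = card B"
    using assms by (metis Max_in card_Suc_Diff1)
  then have "[Suc (card (B \<inter> {Min B..<Max B})) = Suc 0] (mod d)"
    using assms unfolding good_def by simp
  then have "[card (B \<inter> {Min B..<Max B}) = 0] (mod d)"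
    by (simp add: cong_Suc_iff)
  ultimately show ?thesis
    by (metis add.right_neutral cong_add_lcancel_nat cong_trans)
qed

lemma card_between_cong:
  assumes "\<And>a b. a \<in> C \<Longrightarrow> b \<in> C \<Longrightarrow> a < b \<Longrightarrow> C \<inter> {a<..<b} = {} \<Longrightarrow> [b = a + 1] (mod d)"
    and "x \<in> C" "y \<in> C" "x \<le> y"
  shows "[y = x + card (C \<inter> {x..<y})] (mod d)"
  using assms(3,4)
proof (induction y rule: less_induct)
  case (less y)
  show ?case
  proof (cases "x = y")
    case False
    let ?A = "C \<inter> {x..<y}"
    have A: "finite ?A" "?A \<noteq> {}" using less.prems False assms(2) by auto
    define z where "z = Max ?A"
    have z: "z \<in> C" "x \<le> z" "z < y" using Max_in[OF A] unfolding z_def by auto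
    have up: "u \<le> z" if "u \<in> C" "x \<le> u" "u < y" for u
      unfolding z_def using A that by (intro Max_ge) auto
    have "C \<inter> {z<..<y} = {}" using up z by fastforce
    then have "[y = z + 1] (mod d)" using assms(1) z less.prems by blast
    moreover have "[z = x + card (C \<inter> {x..<z})] (mod d)" using less.IH z by blast
    moreover have "?A = insert z (C \<inter> {x..<z})" using up z by fastforce
    then have "card ?A = Suc (card (C \<inter> {x..<z}))" by simp
    ultimately show ?thesis
      using cong_trans[of y "Suc z" d "Suc (x + card (C \<inter> {x..<z}))"] by (simp add: cong_Suc_iff)
  qed simp
qed

lemma between_neighbours_closed:
  assumes P: "partition_on S P" and nc: "noncrossing P"
    and C: "C \<in> P" "a \<in> C" "b \<in> C" "C \<inter> {a<..<b} = {}"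
    and D: "D \<in> P" "u \<in> D" "v \<in> D" "a < u" "u < b"
  shows "a < v \<and> v < b"
proof -
  have "D \<noteq> C" using C D by auto
  then have "v \<noteq> a" "v \<noteq> b" using partition_on_block_eq[OF P] C D by blast+
  moreover have "\<not> v < a" using noncrossingD[OF nc D(1) C(1), of v a u b] C D \<open>D \<noteq> C\<close> by blast
  moreover have "\<not> b < v" using noncrossingD[OF nc C(1) D(1), of a u b v] C D \<open>D \<noteq> C\<close> by blast
  ultimately show ?thesis by linarith
qed

text \<open>The gap just before \<open>b\<close> carries the number \<open>b - 1\<close>. A block
  that meets the open interval from \<open>a\<close> to \<open>b\<close> stays inside it, so no pair
  is separated by only one of the two gaps.\<close>

lemma same_gap_between:
  assumes "partition_on S P" "noncrossing P"
    and "C \<in> P" "a \<in> C" "b \<in> C" "a < b" "C \<inter> {a<..<b} = {}"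
  shows "same_gap P a (b - 1)"
  unfolding same_gap_def
proof (intro ballI)
  fix D u v assume "D \<in> P" "u \<in> D" "v \<in> D"
  then show "((u \<le> a) = (v \<le> a)) = ((u \<le> b - 1) = (v \<le> b - 1))"
    using between_neighbours_closed[OF assms(1-5,7), of D u v]
      between_neighbours_closed[OF assms(1-5,7), of D v u] assms(6) by linarith
qed

lemma between_Min_Max_closed:
  assumes P: "partition_on S P" and nc: "noncrossing P" and fin: "finite C"
    and C: "C \<in> P" and D: "D \<in> P" "u \<in> D" "v \<in> D" "Min C \<le> u" "u \<le> Max C"
  shows "Min C \<le> v \<and> v \<le> Max C"
proof (cases "D = C")
  case True
  then show ?thesis using fin D by simp
next
  case False
  have C': "Min C \<in> C" "Max C \<in> C"
    using fin C partition_on_memD[OF P C] by (auto intro: Min_in Max_in)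
  then have ne: "u \<noteq> Min C" "u \<noteq> Max C"
    using False partition_on_block_eq[OF P] C D by blast+
  have "\<not> v < Min C" using noncrossingD[OF nc D(1) C, of v "Min C" u "Max C"] C' D False ne by force
  moreover have "\<not> Max C < v" using noncrossingD[OF nc C D(1), of "Min C" u "Max C" v] C' D False ne by force
  ultimately show ?thesis by linarith
qed

lemma same_gap_Min_Max:
  assumes "partition_on S P" "noncrossing P" "finite C" "C \<in> P" "0 < Min C"
  shows "same_gap P (Min C - 1) (Max C)"
  unfolding same_gap_def
proof (intro ballI)
  fix D u v assume "D \<in> P" "u \<in> D" "v \<in> D"
  moreover have "Min C \<le> Max C" using assms partition_on_memD[OF assms(1,4)] by simp
  ultimately show "((u \<le> Min C - 1) = (v \<le> Min C - 1)) = ((u \<le> Max C) = (v \<le> Max C))"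
    using between_Min_Max_closed[OF assms(1-4), of D u v]
      between_Min_Max_closed[OF assms(1-4), of D v u] assms(5) by linarith
qed

text \<open>The interval between two equivalent gaps is a concatenation of the hulls of its outermost
  blocks, and each of these hulls has length congruent to 1.\<close>

lemma card_same_gap_cong:
  assumes P: "partition_on {1..n} P" "noncrossing P"
    and "i \<le> j" "j \<le> n" "same_gap P i j"
    and hull: "\<And>C. C \<in> P \<Longrightarrow> C \<subseteq> {i<..j} \<Longrightarrow> [Max C = Min C] (mod d)"
  shows "[j = i + card {y\<in>{i<..j}. same_gap P i y}] (mod d)"
  using assms(3-)
proof (induction j rule: less_induct)
  case (less j)
  show ?case
  proof (cases "i = j")
    case False
    then have ij: "i < j" using less.prems by simp
    then obtain C where C: "C \<in> P" "j \<in> C"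
      using partition_on_obtain[OF P(1), of j] less.prems by auto
    have Csub: "C \<subseteq> {i<..j}"
    proof
      fix c assume "c \<in> C"
      then show "c \<in> {i<..j}" using same_gapD[OF less.prems(3) C(1) C(2), of c] ij by auto
    qed
    then have fin: "finite C" by (rule finite_subset) simp
    have MaxC: "Max C = j" using fin C Csub by (intro Max_eqI) auto
    define p where "p = Min C"
    have "C \<noteq> {}" using C by blast
    then have "p \<in> C" unfolding p_def by (rule Min_in[OF fin])
    then have p: "p \<in> C" "i < p" "p \<le> j" using Csub by auto
    have g: "same_gap P (p - 1) j"
      using same_gap_Min_Max[OF P fin C(1)] p MaxC unfolding p_def by simp
    then have gi: "same_gap P i (p - 1)" using less.prems(3) same_gap_sym same_gap_trans by blast
    have IH: "[p - 1 = i + card {y\<in>{i<..p - 1}. same_gap P i y}] (mod d)"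
    proof (rule less.IH[OF _ _ _ gi])
      show "p - 1 < j" "i \<le> p - 1" "p - 1 \<le> n" using p less.prems by auto
      fix D assume D: "D \<in> P" "D \<subseteq> {i<..p - 1}"
      have "{i<..p - 1} \<subseteq> {i<..j}" using p by auto
      with D show "[Max D = Min D] (mod d)" using less.prems(4) by blast
    qed
    \<comment> \<open>Such a gap lies inside the hull of \<open>C\<close> and separates
      \<open>p\<close> from \<open>j\<close>, while gap \<open>j\<close> does not. So each outermost
      block contributes only its last point to the count.\<close>
    have no: "\<not> same_gap P i y" if "p \<le> y" "y < j" for y
    proof
      assume "same_gap P i y"
      then have "same_gap P y j" using less.prems(3) same_gap_sym same_gap_trans by blast
      from same_gapD[OF this C(1) p(1) C(2)] that p show False by linarith
    qed
    have "{y\<in>{i<..j}. same_gap P i y} = insert j {y\<in>{i<..p - 1}. same_gap P i y}"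
    proof (intro set_eqI iffI)
      fix y assume "y \<in> {y\<in>{i<..j}. same_gap P i y}"
      then show "y \<in> insert j {y\<in>{i<..p - 1}. same_gap P i y}" using no[of y] by force
    next
      fix y assume "y \<in> insert j {y\<in>{i<..p - 1}. same_gap P i y}"
      then show "y \<in> {y\<in>{i<..j}. same_gap P i y}" using p ij less.prems by auto
    qed
    moreover have "j \<notin> {y\<in>{i<..p - 1}. same_gap P i y}" using p by auto
    ultimately have c: "card {y\<in>{i<..j}. same_gap P i y} = Suc (card {y\<in>{i<..p - 1}. same_gap P i y})"
      by simp
    have "[j = Suc (p - 1)] (mod d)" using less.prems(4)[OF C(1) Csub] MaxC p unfolding p_def by simp
    moreover have "[Suc (p - 1) = Suc (i + card {y\<in>{i<..p - 1}. same_gap P i y})] (mod d)"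
      using IH by (simp only: cong_Suc_iff)
    ultimately show ?thesis unfolding c using cong_trans by simp blast
  qed simp
qed

text \<open>Gap \<open>a\<close> separates \<open>a\<close> from \<open>b\<close>, so every
  equivalent gap must do so too and lies between them.\<close>

lemma gap_class_between:
  assumes P: "partition_on {1..n} P" "noncrossing P"
    and C: "C \<in> P" "a \<in> C" "b \<in> C" "a < b"
  shows "gap_class n P a = insert a {y\<in>{a<..b - 1}. same_gap P a y}"
proof (intro set_eqI iffI)
  have ab: "a \<in> {1..n}" "b \<in> {1..n}" using partition_on_memD[OF P(1) C(1)] C by auto
  fix y
  {
    assume "y \<in> gap_class n P a"
    then have "same_gap P a y" unfolding gap_class_def by simp
    with same_gapD[OF this C(1-3)] C(4)
    show "y \<in> insert a {y\<in>{a<..b - 1}. same_gap P a y}" by (cases "y = a") auto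
  next
    assume "y \<in> insert a {y\<in>{a<..b - 1}. same_gap P a y}"
    then show "y \<in> gap_class n P a" unfolding gap_class_def using ab by auto
  }
qed

text \<open>The bridge between a partition and its dual: if the nested blocks have hulls of length
  congruent to 1, then \<open>b\<close> is congruent to \<open>a + 1\<close> iff the dual block of
  gap \<open>a\<close> has size congruent to 1.\<close>

lemma card_gap_class_between:
  assumes P: "partition_on {1..n} P" "noncrossing P"
    and C: "C \<in> P" "a \<in> C" "b \<in> C" "a < b" "C \<inter> {a<..<b} = {}"
    and hull: "\<And>D. D \<in> P \<Longrightarrow> D \<subseteq> {a<..<b} \<Longrightarrow> [Max D = Min D] (mod d)"
  shows "[card (gap_class n P a) + a = b] (mod d)"
proof -
  have bn: "b \<le> n" using partition_on_memD[OF P(1) C(1)] C by auto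
  let ?Y = "{y\<in>{a<..b - 1}. same_gap P a y}"
  have "[b - 1 = a + card ?Y] (mod d)"
  proof (rule card_same_gap_cong[OF P _ _ same_gap_between[OF P C]])
    show "a \<le> b - 1" "b - 1 \<le> n" using C(4) bn by auto
    fix D assume "D \<in> P" "D \<subseteq> {a<..b - 1}"
    moreover have "{a<..b - 1} \<subseteq> {a<..<b}" using C(4) by auto
    ultimately show "[Max D = Min D] (mod d)" using hull by blast
  qed
  then have "[Suc (b - 1) = Suc (a + card ?Y)] (mod d)" by (simp only: cong_Suc_iff)
  moreover have "card (gap_class n P a) = Suc (card ?Y)"
    unfolding gap_class_between[OF P C(1-4)] by (subst card_insert_disjoint) auto
  ultimately show ?thesis using C(4) by (simp add: cong_sym add.commute)
qed

text \<open>Induction on the distance of neighbours \<open>a < b\<close>. Blocks nested between them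
  have closer neighbours, hence are good and have hulls of length congruent to 1, so the size of the
  dual block of gap \<open>a\<close> determines \<open>b - a\<close>.\<close>

lemma good_if_dual:
  assumes P: "partition_on {1..n} P" "noncrossing P"
    and card1: "\<And>B. B \<in> P \<Longrightarrow> [card B = 1] (mod d)"
    and dual: "\<And>i. i \<in> {1..n} \<Longrightarrow> [card (gap_class n P i) = 1] (mod d)"
    and B: "B \<in> P"
  shows "good d B"
proof -
  have gap: "[b = a + 1] (mod d)"
    if "C \<in> P" "a \<in> C" "b \<in> C" "a < b" "C \<inter> {a<..<b} = {}" for C a b
    using that
  proof (induction "b - a" arbitrary: C a b rule: less_induct)
    case less
    have an: "a \<in> {1..n}" using partition_on_memD[OF P(1) less.prems(1)] less.prems by auto
    have "[card (gap_class n P a) + a = b] (mod d)"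
    proof (rule card_gap_class_between[OF P less.prems])
      fix D assume D: "D \<in> P" "D \<subseteq> {a<..<b}"
      have "[v = u + card (D \<inter> {u..<v})] (mod d)" if "u \<in> D" "v \<in> D" "u \<le> v" for u v
      proof (rule card_between_cong[OF _ that])
        fix u v assume uv: "u \<in> D" "v \<in> D" "u < v" "D \<inter> {u<..<v} = {}"
        moreover have "u \<in> {a<..<b}" "v \<in> {a<..<b}" using D uv by blast+
        then have "v - u < b - a" by auto
        ultimately show "[v = u + 1] (mod d)" using less.hyps D by blast
      qed
      then have "good d D" unfolding good_def using card1 D by blast
      moreover have "finite D" using D finite_subset by blast
      ultimately show "[Max D = Min D] (mod d)"
        using good_Max_Min D partition_on_memD[OF P(1)] by blast
    qed
    moreover have "[card (gap_class n P a) + a = 1 + a] (mod d)"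
      using dual[OF an] by (simp only: cong_add_rcancel_nat)
    ultimately show ?case by (metis add.commute cong_sym cong_trans)
  qed
  show ?thesis
    unfolding good_def using card1[OF B] card_between_cong[of B d] gap[OF B] by blast
qed

text \<open>A gap that separates no block belongs to the outermost dual block, where the congruence
  for \<open>n\<close> enters. Any other gap is equivalent to the gap after \<open>a\<close> for the
  closest pair \<open>a\<close>, \<open>b\<close> of a common block around it.\<close>

lemma dual_if_good:
  assumes P: "partition_on {1..n} P" "noncrossing P" and n: "[n = 1] (mod d)"
    and good: "\<And>B. B \<in> P \<Longrightarrow> good d B"
    and j: "j \<in> {1..n}"
  shows "[card (gap_class n P j) = 1] (mod d)"
proof -
  have hull: "[Max C = Min C] (mod d)" if "C \<in> P" for C
    using good_Max_Min[OF good[OF that]] partition_on_memD[OF P(1) that] finite_subset by blast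
  let ?sep = "\<lambda>(a, b). \<exists>C\<in>P. a \<in> C \<and> b \<in> C \<and> a \<le> j \<and> j < b"
  show ?thesis
  proof (cases "\<exists>ab. ?sep ab")
    case False
    have nosep: "(u \<le> j) = (v \<le> j)" if "D \<in> P" "u \<in> D" "v \<in> D" for D u v
    proof -
      have "\<not> ?sep (u, v)" "\<not> ?sep (v, u)" using False by blast+
      with that show ?thesis unfolding prod.case using not_le by blast
    qed
    have D1n: "0 < u \<and> u \<le> n" if "D \<in> P" "u \<in> D" for D u
      using partition_on_memD[OF P(1) that(1)] that(2) by (auto simp: Suc_le_eq)
    \<comment> \<open>Gap 0 is not a point of \<open>{1..n}\<close>; it serves as a copy of gap
      \<open>n\<close> at the other end, so that the count can run over all of
      \<open>{0<..n}\<close>.\<close>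
    have "same_gap P 0 j" "same_gap P 0 n"
      unfolding same_gap_def
    proof (intro ballI)
      fix D u v assume D: "D \<in> P" "u \<in> D" "v \<in> D"
      show "((u \<le> 0) = (v \<le> 0)) = ((u \<le> j) = (v \<le> j))"
        using D1n[OF D(1,2)] D1n[OF D(1,3)] nosep[OF D] by simp
    next
      show "\<forall>D\<in>P. \<forall>u\<in>D. \<forall>v\<in>D. ((u \<le> 0) = (v \<le> 0)) = ((u \<le> n) = (v \<le> n))"
        using D1n by (metis not_le)
    qed
    have "gap_class n P j = gap_class n P 0"
      by (rule gap_class_cong[OF \<open>same_gap P 0 j\<close>, symmetric])
    also have "\<dots> = {y\<in>{0<..n}. same_gap P 0 y}"
      unfolding gap_class_def by (simp add: atLeastSucAtMost_greaterThanAtMost)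
    finally have "gap_class n P j = {y\<in>{0<..n}. same_gap P 0 y}" .
    moreover have "[n = 0 + card {y\<in>{0<..n}. same_gap P 0 y}] (mod d)"
      using hull \<open>same_gap P 0 n\<close> by (intro card_same_gap_cong[OF P]) auto
    ultimately show ?thesis using n by (metis add_0 cong_sym cong_trans)
  next
    case True
    then obtain ab where sep: "?sep ab" by blast
    define ab0 where "ab0 = arg_min (\<lambda>(a, b). b - a) ?sep"
    obtain a b where ab0: "ab0 = (a, b)" by (cases ab0)
    have "?sep ab0" unfolding ab0_def by (rule arg_min_natI[of ?sep, OF sep])
    then obtain C where C: "C \<in> P" "a \<in> C" "b \<in> C" "a \<le> j" "j < b" unfolding ab0 by blast
    have least: "b - a \<le> v - u" if "D \<in> P" "u \<in> D" "v \<in> D" "u \<le> j" "j < v" for D u v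
      using arg_min_nat_le[of ?sep "(u, v)" "\<lambda>(a, b). b - a"] that
      unfolding ab0_def[symmetric] ab0 by auto
    have cons: "C \<inter> {a<..<b} = {}"
    proof (rule ccontr)
      assume "C \<inter> {a<..<b} \<noteq> {}"
      then obtain c where "c \<in> C" "a < c" "c < b" by auto
      then show False using least[OF C(1), of a c] least[OF C(1), of c b] C by linarith
    qed
    have closed: "a < v \<and> v < b" if "D \<in> P" "u \<in> D" "v \<in> D" "a < u" "u < b" for D u v
      using between_neighbours_closed[OF P C(1-3) cons that] .
    \<comment> \<open>A pair distinguishing the two gaps has one point in \<open>{a<..j}\<close>.
      Its block is nested between \<open>a\<close> and \<open>b\<close>, so the other point lies
      between \<open>j\<close> and \<open>b\<close>, and the pair would be closer than
      \<open>a\<close> and \<open>b\<close>.\<close>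
    have "same_gap P a j"
      unfolding same_gap_def
    proof (intro ballI)
      fix D u v assume D: "D \<in> P" "u \<in> D" "v \<in> D"
      show "((u \<le> a) = (v \<le> a)) = ((u \<le> j) = (v \<le> j))"
        using closed[OF D] closed[OF D(1,3,2)] least[OF D] least[OF D(1,3,2)] C(4,5)
        by linarith
    qed
    then have "gap_class n P j = gap_class n P a" using gap_class_cong by metis
    moreover have "[card (gap_class n P a) + a = b] (mod d)"
      using C cons hull by (intro card_gap_class_between[OF P]) auto
    moreover have "[b = a + card (C \<inter> {a..<b})] (mod d)"
      using goodD[OF good] C by simp
    moreover have "C \<inter> {a..<b} = {a}" using cons C by fastforce
    ultimately have "[card (gap_class n P j) + a = 1 + a] (mod d)"
      by (metis add.commute card.empty card_insert_disjoint cong_trans empty_iff finite.emptyI One_nat_def)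
    then show ?thesis by (simp only: cong_add_rcancel_nat)
  qed
qed

definition ND :: "nat \<Rightarrow> nat set \<Rightarrow> nat set set set" where
  "ND d S = {P. partition_on S P \<and> noncrossing P \<and> (\<forall>B\<in>P. good d B)}"

theorem NC_eq_ND:
  assumes "[n = 1] (mod d)"
  shows "NC d n = ND d {1..n}"
proof (intro set_eqI iffI)
  fix P assume "P \<in> NC d n"
  then show "P \<in> ND d {1..n}"
    using good_if_dual[of n P d] kreweras_dual_eq[of n P]
    unfolding NC_def ND_def noncrossing_partition_def by auto
next
  fix P assume "P \<in> ND d {1..n}"
  then show "P \<in> NC d n"
    using dual_if_good[OF _ _ assms, of P] kreweras_dual_eq[of n P]
    unfolding NC_def ND_def noncrossing_partition_def good_def by auto
qed

section \<open>Cover relations\<close>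

text \<open>Only the \<open>d\<close> interval pieces carry a congruence: together they remove a
  multiple of \<open>d\<close> points, so the size of the remaining piece keeps its residue.\<close>

definition split_points :: "nat \<Rightarrow> nat set \<Rightarrow> (nat \<Rightarrow> nat) \<Rightarrow> bool" where
  "split_points d B x \<longleftrightarrow> (\<forall>i\<le>d. x i \<in> B) \<and>
     (\<forall>i<d. x i < x (Suc i) \<and> [card (B \<inter> {x i<..x (Suc i)}) = 1] (mod d))"

text \<open>A list and not a set, in the order of increasing minima that \<open>edge_label\<close>
  uses; the piece outside the intervals comes first.\<close>

definition pieces :: "nat \<Rightarrow> nat set \<Rightarrow> (nat \<Rightarrow> nat) \<Rightarrow> nat set list" where
  "pieces d B x = (B - {x 0<..x d}) # map (\<lambda>i. B \<inter> {x i<..x (Suc i)}) [0..<d]"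

definition split_step :: "nat \<Rightarrow> nat set set \<Rightarrow> nat set set \<Rightarrow> bool" where
  "split_step d R P \<longleftrightarrow>
     (\<exists>B\<in>P. \<exists>x. split_points d B x \<and> R = P - {B} \<union> set (pieces d B x))"

lemma chain_mono:
  fixes x :: "nat \<Rightarrow> nat"
  assumes "\<And>i. i < d \<Longrightarrow> x i < x (Suc i)" "i \<le> j" "j \<le> d"
  shows "x i \<le> x j"
  using assms(2,3)
proof (induction j rule: dec_induct)
  case (step n)
  then show ?case using assms(1)[of n] by simp
qed simp

lemma chain_interval_covered:
  fixes x :: "nat \<Rightarrow> nat"
  assumes "x 0 < z" "z \<le> x d"
  obtains i where "i < d" "x i < z" "z \<le> x (Suc i)"
proof -
  have "x 0 < z \<Longrightarrow> z \<le> x d \<Longrightarrow> \<exists>i<d. x i < z \<and> z \<le> x (Suc i)"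
  proof (induction d)
    case (Suc d)
    then show ?case by (cases "z \<le> x d") (auto intro: less_SucI)
  qed simp
  then show ?thesis using assms that by blast
qed

lemma split_pointsD:
  assumes "split_points d B x"
  shows "i \<le> d \<Longrightarrow> x i \<in> B" "i < d \<Longrightarrow> x i < x (Suc i)"
    "i < d \<Longrightarrow> [card (B \<inter> {x i<..x (Suc i)}) = 1] (mod d)"
    "i \<le> j \<Longrightarrow> j \<le> d \<Longrightarrow> x i \<le> x j"
  using assms chain_mono[of d x i j] unfolding split_points_def by auto

lemma set_pieces:
  "set (pieces d B x) = insert (B - {x 0<..x d}) ((\<lambda>i. B \<inter> {x i<..x (Suc i)}) ` {..<d})"
  unfolding pieces_def by (auto simp: lessThan_atLeast0)

lemma pieces_subset: "A \<in> set (pieces d B x) \<Longrightarrow> A \<subseteq> B"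
  unfolding set_pieces by auto

lemma partition_on_pieces:
  assumes x: "split_points d B x"
  shows "partition_on B (set (pieces d B x))"
proof (rule partition_onI)
  show "\<Union> (set (pieces d B x)) = B"
  proof (intro equalityI subsetI)
    fix z assume z: "z \<in> B"
    show "z \<in> \<Union> (set (pieces d B x))"
    proof (cases "z \<in> {x 0<..x d}")
      case True
      then obtain i where "i < d" "x i < z" "z \<le> x (Suc i)"
        using chain_interval_covered[of x z d] by auto
      then show ?thesis using z unfolding set_pieces by auto
    qed (use z in \<open>auto simp: set_pieces\<close>)
  qed (use pieces_subset in blast)
next
  have first: "B \<inter> {x i<..x (Suc i)} \<inter> (B - {x 0<..x d}) = {}" if "i < d" for i
    using split_pointsD(4)[OF x, of 0 i] split_pointsD(4)[OF x, of "Suc i" d] that by auto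
  have less: "{x i<..x (Suc i)} \<inter> {x j<..x (Suc j)} = {}" if "i < j" "j < d" for i j
    using split_pointsD(4)[OF x, of "Suc i" j] that by auto
  have neq: "{x i<..x (Suc i)} \<inter> {x j<..x (Suc j)} = {}" if "i \<noteq> j" "i < d" "j < d" for i j
    using less[of i j] less[of j i] that by (metis Int_commute linorder_neqE_nat)
  fix p q assume "p \<in> set (pieces d B x)" "q \<in> set (pieces d B x)" "p \<noteq> q"
  then consider i where "i < d" "p = B \<inter> {x i<..x (Suc i)}" "q = B - {x 0<..x d}"
    | i where "i < d" "q = B \<inter> {x i<..x (Suc i)}" "p = B - {x 0<..x d}"
    | i j where "i < d" "j < d" "i \<noteq> j" "p = B \<inter> {x i<..x (Suc i)}" "q = B \<inter> {x j<..x (Suc j)}"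
    unfolding set_pieces by (elim insertE imageE) (auto simp only: lessThan_iff)
  then show "disjnt p q"
  proof cases
    case (1 i) then show ?thesis using first[of i] unfolding disjnt_def by simp
  next
    case (2 i) then show ?thesis using first[of i] unfolding disjnt_def by (simp add: Int_commute)
  next
    case (3 i j) then show ?thesis using neq[of i j] unfolding disjnt_def by blast
  qed
next
  show "{} \<notin> set (pieces d B x)"
  proof
    assume "{} \<in> set (pieces d B x)"
    then consider "{} = B - {x 0<..x d}" | i where "i < d" "{} = B \<inter> {x i<..x (Suc i)}"
      unfolding set_pieces by blast
    then show False
    proof cases
      case 1
      moreover have "x 0 \<in> B - {x 0<..x d}" using split_pointsD(1)[OF x, of 0] by simp
      ultimately show False by blast
    next
      case (2 i)
      moreover have "x (Suc i) \<in> B \<inter> {x i<..x (Suc i)}" using split_pointsD(1,2)[OF x] 2(1) by simp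
      ultimately show False by blast
    qed
  qed
qed

lemma sorted_Min_pieces:
  assumes x: "split_points d B x" and fin: "finite B"
  shows "sorted_wrt (<) (map Min (pieces d B x))"
proof -
  have le: "Min (B - {x 0<..x d}) \<le> x 0"
    using split_pointsD(1)[OF x, of 0] fin by (intro Min_le) auto
  have piece: "x i < Min (B \<inter> {x i<..x (Suc i)}) \<and> Min (B \<inter> {x i<..x (Suc i)}) \<le> x (Suc i)"
    if "i < d" for i
  proof -
    have "x (Suc i) \<in> B \<inter> {x i<..x (Suc i)}" using split_pointsD(1,2)[OF x] that by auto
    moreover have "finite (B \<inter> {x i<..x (Suc i)})" using fin by blast
    ultimately show ?thesis by (metis (no_types, lifting) Int_iff Min_in empty_iff greaterThanAtMost_iff)
  qed
  have "sorted_wrt (<) (map (\<lambda>i. Min (B \<inter> {x i<..x (Suc i)})) [0..<d])"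
    unfolding sorted_wrt_iff_nth_less
  proof (intro allI impI)
    fix i j assume "i < j" "j < length (map (\<lambda>i. Min (B \<inter> {x i<..x (Suc i)})) [0..<d])"
    then show "map (\<lambda>i. Min (B \<inter> {x i<..x (Suc i)})) [0..<d] ! i
      < map (\<lambda>i. Min (B \<inter> {x i<..x (Suc i)})) [0..<d] ! j"
      using piece[of i] piece[of j] split_pointsD(4)[OF x, of "Suc i" j] by simp
  qed
  moreover have "Min (B - {x 0<..x d}) < Min (B \<inter> {x i<..x (Suc i)})" if "i < d" for i
    using le piece[OF that] split_pointsD(4)[OF x, of 0 i] that by simp
  ultimately show ?thesis unfolding pieces_def by (simp add: comp_def)
qed

text \<open>Strictness supplies the injectivity of \<open>f\<close> on the set that the locale
  behind \<open>sorted_key_list_of_set\<close> requires.\<close>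

lemma (in linorder) sorted_key_list_of_set_strict_sorted:
  assumes "sorted_wrt (<) (map f xs)"
  shows "sorted_key_list_of_set f (set xs) = xs"
proof -
  have 1: "distinct xs" "inj_on f (set xs)" "sorted (map f xs)"
    using assms by (auto simp: strict_sorted_iff distinct_map)
  interpret folding_insort_key "(\<le>)" "(<)" "set xs" f
    using 1(2) by unfold_locales
  show ?thesis by (rule idem_if_sorted_distinct[OF subset_refl 1(3,1)])
qed

lemma distinct_pieces:
  assumes "split_points d B x" "finite B"
  shows "distinct (pieces d B x)"
  using sorted_Min_pieces[OF assms] distinct_map strict_sorted_iff by blast

lemma card_set_pieces:
  assumes "split_points d B x" "finite B"
  shows "card (set (pieces d B x)) = Suc d"
  using distinct_card[OF distinct_pieces[OF assms]] by (simp add: pieces_def)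

lemma card_block_inter_cong:
  assumes x: "split_points d B x" and fin: "finite B"
  shows "i \<le> d \<Longrightarrow> [card (B \<inter> {x 0<..x i}) = i] (mod d)"
proof (induction i)
  case (Suc i)
  have "{x 0<..x (Suc i)} = {x 0<..x i} \<union> {x i<..x (Suc i)}"
    using split_pointsD(2,4)[OF x, of i] split_pointsD(4)[OF x, of 0 i] Suc.prems by auto
  then have "B \<inter> {x 0<..x (Suc i)} = (B \<inter> {x 0<..x i}) \<union> (B \<inter> {x i<..x (Suc i)})" by blast
  then have "card (B \<inter> {x 0<..x (Suc i)}) = card (B \<inter> {x 0<..x i}) + card (B \<inter> {x i<..x (Suc i)})"
    using fin by (simp only:) (intro card_Un_disjoint, auto)
  moreover have "[\<dots> = i + 1] (mod d)"
    using Suc split_pointsD(3)[OF x, of i] by (intro cong_add) auto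
  ultimately show ?case by simp
qed simp

text \<open>Interval pieces are convex in \<open>B\<close>, so counts inside them do not change. For
  the outer piece, the removed points lie either entirely between two given elements or entirely
  elsewhere, and they are a multiple of \<open>d\<close> in number.\<close>

lemma good_pieces:
  assumes x: "split_points d B x" and fin: "finite B" and B: "good d B"
    and A: "A \<in> set (pieces d B x)"
  shows "good d A"
proof -
  from A consider "A = B - {x 0<..x d}" | i where "i < d" "A = B \<inter> {x i<..x (Suc i)}"
    unfolding set_pieces by auto
  then show ?thesis
  proof cases
    case 1
    let ?I = "B \<inter> {x 0<..x d}"
    have I: "[card ?I = 0] (mod d)"
      using card_block_inter_cong[OF x fin, of d] cong_trans by (auto simp: cong_def)
    have drop: "[card (U - ?I) = card U] (mod d)" if "?I \<subseteq> U" "finite U" for U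
    proof -
      have "card U = card (U - ?I) + card ?I"
        using that card_Diff_subset[of ?I U] card_mono[of U ?I] fin by auto
      then show ?thesis using cong_add[OF cong_refl I, of "card (U - ?I)"] by (simp add: cong_sym)
    qed
    have "A = B - ?I" using 1 by blast
    then have "[card A = 1] (mod d)"
      using drop[of B] fin B cong_trans unfolding good_def by blast
    moreover have "[v = u + card (A \<inter> {u..<v})] (mod d)" if uv: "u \<in> A" "v \<in> A" "u \<le> v" for u v
    proof -
      have uvB: "[v = u + card (B \<inter> {u..<v})] (mod d)" using goodD[OF B] uv 1 by blast
      consider "v \<le> x 0 \<or> x d < u" | "u \<le> x 0" "x d < v" using uv 1 by fastforce
      then show ?thesis
      proof cases
        case 1
        then have "A \<inter> {u..<v} = B \<inter> {u..<v}" using \<open>A = B - ?I\<close> by auto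
        then show ?thesis using uvB by simp
      next
        case 2
        then have "A \<inter> {u..<v} = B \<inter> {u..<v} - ?I" "?I \<subseteq> B \<inter> {u..<v}"
          using \<open>A = B - ?I\<close> uv by (auto simp: le_less_trans)
        then have "[card (A \<inter> {u..<v}) = card (B \<inter> {u..<v})] (mod d)" using drop by simp
        then show ?thesis using uvB by (meson cong_add_lcancel_nat cong_sym cong_trans)
      qed
    qed
    ultimately show ?thesis unfolding good_def by blast
  next
    case (2 i)
    have "[v = u + card (A \<inter> {u..<v})] (mod d)" if uv: "u \<in> A" "v \<in> A" "u \<le> v" for u v
    proof -
      have "A \<inter> {u..<v} = B \<inter> {u..<v}" using 2 uv by auto
      then show ?thesis using goodD[OF B, of u v] uv 2 by simp
    qed
    then show ?thesis using 2 split_pointsD(3)[OF x] unfolding good_def by blast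
  qed
qed

text \<open>All pieces but the first are convex in the block, so no two pieces can cross.\<close>

lemma noncrossing_pieces:
  assumes x: "split_points d B x"
  shows "noncrossing (set (pieces d B x))"
proof (rule noncrossingI)
  fix A A' and i j k l :: nat
  assume *: "A \<in> set (pieces d B x)" "A' \<in> set (pieces d B x)" "i < j" "j < k" "k < l"
    "i \<in> A" "k \<in> A" "j \<in> A'" "l \<in> A'"
  have conv: "v \<in> C \<or> C = B - {x 0<..x d}"
    if "C \<in> set (pieces d B x)" "u \<in> C" "w \<in> C" "v \<in> B" "u < v" "v < w" for C u v w
    using that unfolding set_pieces by auto
  have "j \<in> B" "k \<in> B" using * pieces_subset by blast+
  then have "j \<in> A \<or> k \<in> A' \<or> A = A'"
    using conv[of A i k j] conv[of A' j l k] * by blast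
  then show "A = A'" using partition_on_block_eq[OF partition_on_pieces[OF x]] * by blast
qed

lemma ND_memD:
  assumes "P \<in> ND d S" "B \<in> P"
  shows "good d B" "B \<subseteq> S" "B \<noteq> {}"
  using assms partition_on_memD unfolding ND_def by blast+

lemma NDD: "P \<in> ND d S \<Longrightarrow> partition_on S P" "P \<in> ND d S \<Longrightarrow> noncrossing P"
  unfolding ND_def by auto

context
  fixes d S P B x
  assumes P: "P \<in> ND d S" and B: "B \<in> P" and x: "split_points d B x" and fin: "finite S"
begin

private lemma finB: "finite B" using ND_memD(2)[OF P B] fin finite_subset by blast

lemma partition_on_split: "partition_on S (P - {B} \<union> set (pieces d B x))"
proof (rule partition_onI)
  have U: "\<Union> (set (pieces d B x)) = B" using partition_on_pieces[OF x] partition_onD1 by blast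
  show "\<Union> (P - {B} \<union> set (pieces d B x)) = S"
    using partition_onD1[OF NDD(1)[OF P]] B unfolding Union_Un_distrib U by blast
  fix p q assume "p \<in> P - {B} \<union> set (pieces d B x)" "q \<in> P - {B} \<union> set (pieces d B x)" "p \<noteq> q"
  moreover have "disjnt p q" if "p \<in> P - {B}" "q \<in> set (pieces d B x)" for p q
    using that B pieces_subset[of q d B x] partition_on_block_eq[OF NDD(1)[OF P], of p B]
    unfolding disjnt_def by blast
  moreover have "disjnt p q" if "p \<in> P" "q \<in> P" "p \<noteq> q" for p q
    using that partition_on_block_eq[OF NDD(1)[OF P], of p q] unfolding disjnt_def by blast
  moreover have "disjnt p q" if "p \<in> set (pieces d B x)" "q \<in> set (pieces d B x)" "p \<noteq> q" for p q
    using that partition_on_block_eq[OF partition_on_pieces[OF x], of p q] unfolding disjnt_def by blast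
  ultimately show "disjnt p q" using disjnt_sym by blast
next
  show "{} \<notin> P - {B} \<union> set (pieces d B x)"
    using partition_onD3[OF NDD(1)[OF P]] partition_onD3[OF partition_on_pieces[OF x]] by blast
qed

text \<open>Pieces are subsets of \<open>B\<close>, so a piece crossing another block of
  \<open>P\<close> would make \<open>B\<close> cross it.\<close>

lemma split_in_ND: "P - {B} \<union> set (pieces d B x) \<in> ND d S"
  unfolding ND_def
proof (intro CollectI conjI ballI)
  show "partition_on S (P - {B} \<union> set (pieces d B x))" by (rule partition_on_split)
  show "noncrossing (P - {B} \<union> set (pieces d B x))"
  proof (rule noncrossingI)
    fix A A' and i j k l :: nat
    assume *: "i < j" "j < k" "k < l" "i \<in> A" "k \<in> A" "j \<in> A'" "l \<in> A'"
      and A: "A \<in> P - {B} \<union> set (pieces d B x)" and A': "A' \<in> P - {B} \<union> set (pieces d B x)"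
    note nc = noncrossingD[OF NDD(2)[OF P] _ _ *(1-3)]
    from A A' consider "A \<in> P" "A' \<in> P" | "A \<in> set (pieces d B x)" "A' \<in> set (pieces d B x)"
      | "A \<in> set (pieces d B x)" "A' \<in> P - {B}" | "A \<in> P - {B}" "A' \<in> set (pieces d B x)" by blast
    then show "A = A'"
    proof cases
      case 1 then show ?thesis using nc * by blast
    next
      case 2 then show ?thesis using noncrossingD[OF noncrossing_pieces[OF x] _ _ *(1-3)] * by blast
    next
      case 3 then show ?thesis using nc[of B A'] pieces_subset[of A d B x] B * by blast
    next
      case 4 then show ?thesis using nc[of A B] pieces_subset[of A' d B x] B * by blast
    qed
  qed
  fix A assume "A \<in> P - {B} \<union> set (pieces d B x)"
  then show "good d A" using good_pieces[OF x finB ND_memD(1)[OF P B]] ND_memD(1)[OF P] by blast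
qed

lemma disjoint_pieces: "(P - {B}) \<inter> set (pieces d B x) = {}"
proof -
  have False if "A \<in> P" "A \<noteq> B" "A \<in> set (pieces d B x)" for A
    using that pieces_subset[of A d B x] ND_memD(3)[OF P that(1)]
      partition_on_block_eq[OF NDD(1)[OF P] that(1) B] by blast
  then show ?thesis by blast
qed

lemma card_split: "card (P - {B} \<union> set (pieces d B x)) = card P + d"
proof -
  have "finite P" using NDD(1)[OF P] fin finite_elements by blast
  then show ?thesis
    using card_Un_disjoint[OF _ _ disjoint_pieces] card_set_pieces[OF x finB] card_Suc_Diff1[of P B] B by simp
qed

lemma refines_split: "refines S (P - {B} \<union> set (pieces d B x)) P"
  unfolding refines_def using partition_on_split NDD(1)[OF P] B pieces_subset by blast

lemma edge_label_split:
  assumes d: "1 \<le> d"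
  shows "edge_label (P - {B} \<union> set (pieces d B x)) P = x 0"
proof -
  let ?R = "P - {B} \<union> set (pieces d B x)"
  \<comment> \<open>Otherwise \<open>B\<close> would be the only piece, against
    \<open>d + 1 >= 2\<close>. This ensures that the difference with \<open>P\<close> contains all
    the pieces.\<close>
  have "B \<notin> set (pieces d B x)"
  proof
    assume "B \<in> set (pieces d B x)"
    then have "set (pieces d B x) = {B}"
      using partition_on_block_eq[OF partition_on_pieces[OF x]] pieces_subset
        partition_on_memD[OF partition_on_pieces[OF x]] by blast
    then show False using card_set_pieces[OF x finB] d by simp
  qed
  then have diff: "?R - P = set (pieces d B x)" using disjoint_pieces B by blast
  have sorted: "sorted_wrt (<) (map Min (pieces d B x))" by (rule sorted_Min_pieces[OF x finB])
  have "sorted_key_list_of_set Min (?R - P) = pieces d B x"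
    unfolding diff by (rule sorted_key_list_of_set_strict_sorted[OF sorted])
  then have "edge_label ?R P = Max {i \<in> B - {x 0<..x d}. i < Min (B \<inter> {x 0<..x (Suc 0)})}"
    unfolding edge_label_def using d by (simp add: pieces_def nth_append)
  \<comment> \<open>The second piece has its minimum in \<open>{x 0<..x 1}\<close>, and elements of
    the first piece are at most \<open>x 0\<close> or larger than \<open>x d\<close>.\<close>
  also have "\<dots> = x 0"
  proof (rule Max_eqI)
    let ?A = "B \<inter> {x 0<..x (Suc 0)}"
    have "x (Suc 0) \<in> ?A" using split_pointsD(1,2)[OF x] d by auto
    then have m: "Min ?A \<in> ?A" using finB by (intro Min_in) auto
    show "finite {i \<in> B - {x 0<..x d}. i < Min ?A}" using finB by auto
    show "x 0 \<in> {i \<in> B - {x 0<..x d}. i < Min ?A}"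
      using split_pointsD(1)[OF x, of 0] m by auto
    fix y assume "y \<in> {i \<in> B - {x 0<..x d}. i < Min ?A}"
    then show "y \<le> x 0" using m split_pointsD(4)[OF x, of "Suc 0" d] d by force
  qed
  finally show ?thesis .
qed

end

section \<open>Splits that stay above a given refinement\<close>

lemma iterate_step:
  fixes a :: 'a
  assumes "Q 0 a" and "\<And>i u. i < d \<Longrightarrow> Q i u \<Longrightarrow> \<exists>v. r u v \<and> Q (Suc i) v"
  obtains x where "x 0 = a" "\<forall>i<d. r (x i) (x (Suc i))" "\<forall>i\<le>d. Q i (x i)"
proof -
  \<comment> \<open>The guards make a successor exist at every index, also beyond \<open>d\<close>,
    as dependent choice demands.\<close>
  have "\<exists>v. (i < d \<longrightarrow> r u v) \<and> (Suc i \<le> d \<longrightarrow> Q (Suc i) v)" if "i \<le> d \<longrightarrow> Q i u" for i u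
    using assms(2)[of i u] that by (cases "i < d") auto
  then obtain x where "x 0 = a" "\<forall>i. (i \<le> d \<longrightarrow> Q i (x i)) \<and> (i < d \<longrightarrow> r (x i) (x (Suc i)))"
    using dependent_nat_choice[of "\<lambda>i u. (i \<le> d \<longrightarrow> Q i u) \<and> (i = 0 \<longrightarrow> u = a)" "\<lambda>i u v. i < d \<longrightarrow> r u v"] assms(1)
    by (auto; metis)
  then show ?thesis using that by blast
qed

text \<open>For \<open>A\<close> inside the ground set: \<open>A\<close> is a union of blocks of
  \<open>P\<close>. In this form the requirement that new pieces be refined by \<open>P\<close> is
  carried along while they are cut off one at a time.\<close>

definition saturated :: "nat set set \<Rightarrow> nat set \<Rightarrow> bool" where
  "saturated P A \<longleftrightarrow> (\<forall>B\<in>P. B \<subseteq> A \<or> B \<inter> A = {})"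

lemma saturatedD: "saturated P A \<Longrightarrow> B \<in> P \<Longrightarrow> u \<in> B \<Longrightarrow> u \<in> A \<Longrightarrow> B \<subseteq> A"
  unfolding saturated_def by blast

text \<open>If \<open>A\<close> is a block of \<open>R\<close> inside \<open>B\<close>, the points of \<open>B\<close> between two neighbours of \<open>A\<close>
  (or after the last element of \<open>A\<close>) are a multiple of \<open>d\<close> in number. Therefore they
  contain at least \<open>d\<close> outermost blocks of \<open>R\<close>, and the ends of the first \<open>d\<close> of these are split points.\<close>

lemma exists_split_points:
  assumes R: "R \<in> ND d S" and fin: "finite S" and B: "good d B" "saturated R B" "B \<subseteq> S" "B \<noteq> {}" "B \<notin> R"
  obtains x where "split_points d B x" "\<forall>i<d. saturated R (B \<inter> {x i<..x (Suc i)})"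
proof -
  have finB: "finite B" using B fin finite_subset by blast
  have part: "partition_on S R" and nc: "noncrossing R" using R NDD by auto
  have MinB: "Min B \<in> B" using finB B by simp
  then obtain A where A: "A \<in> R" "Min B \<in> A" using partition_on_obtain[OF part] B by blast
  have AB: "A \<subseteq> B" "A \<noteq> B" using saturatedD[OF B(2) A] MinB A B by blast+
  have finA: "finite A" using AB finB finite_subset by blast
  \<comment> \<open>\<open>g\<close> is the first point of \<open>B\<close> missing from
    \<open>A\<close>, and \<open>a\<close>, defined below, is its predecessor in \<open>B\<close>.
    This \<open>a\<close> becomes \<open>x 0\<close>.\<close>
  define g where "g = Min (B - A)"
  have "g \<in> B - A" unfolding g_def using AB finB by (intro Min_in) auto
  then have g: "g \<in> B" "g \<notin> A" by auto
  have below_g: "u \<in> A" if "u \<in> B" "u < g" for u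
    using that finB Min_le[of "B - A" u] unfolding g_def by fastforce
  define a where "a = Max (A \<inter> {..<g})"
  have "Min B < g" using g A finB by (metis Min_le order_le_less)
  then have "a \<in> A \<inter> {..<g}" unfolding a_def using A finA by (intro Max_in) auto
  then have a: "a \<in> A" "a < g" by auto
  have above_a: "g \<le> u" if "u \<in> B" "a < u" for u
  proof (rule ccontr)
    assume "\<not> g \<le> u"
    then have "u \<in> A \<inter> {..<g}" using below_g that by auto
    then have "u \<le> a" unfolding a_def using finA by (intro Max_ge) auto
    then show False using that by simp
  qed
  \<comment> \<open>The points of \<open>B\<close> between \<open>a\<close> and the next element of
    \<open>A\<close>; if there is none, all points of \<open>B\<close> after
    \<open>a\<close>.\<close>
  define G where "G = {y \<in> B. a < y \<and> (\<forall>c\<in>A. a < c \<longrightarrow> y < c)}"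
  have GB: "G \<subseteq> B" and finG: "finite G" unfolding G_def using finB by auto
  have "g < c" if "c \<in> A" "a < c" for c
    using above_a[of c] that AB(1) g(2) by (cases "g = c") auto
  then have gG: "g \<in> G" unfolding G_def using g a by blast
  have GA: "G \<inter> A = {}" unfolding G_def by auto
  have Gdown: "B \<inter> {a<..y} \<subseteq> G" if "y \<in> G" for y
    using that unfolding G_def by fastforce
  have Gsat: "saturated R G"
    unfolding saturated_def
  proof (intro ballI)
    fix D assume D: "D \<in> R"
    show "D \<subseteq> G \<or> D \<inter> G = {}"
    proof (rule ccontr)
      assume "\<not> (D \<subseteq> G \<or> D \<inter> G = {})"
      then obtain y z where yz: "y \<in> D" "y \<in> G" "z \<in> D" "z \<notin> G" by blast
      have DA: "D \<noteq> A" using yz GA by blast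
      then have zA: "z \<notin> A" using partition_on_block_eq[OF part D A(1)] yz by blast
      have zB: "z \<in> B" using saturatedD[OF B(2) D yz(1)] yz GB by blast
      \<comment> \<open>Below \<open>g\<close> all points of \<open>B\<close> belong to
        \<open>A\<close>, so a block can leave \<open>G\<close> only to the right; it would then
        jump over some \<open>c\<close> of \<open>A\<close> and cross \<open>A\<close>.\<close>
      have "a < z" using zA zB below_g a by (metis a(1) linorder_neqE_nat order_less_trans)
      with yz zB obtain c where c: "c \<in> A" "a < c" "c \<le> z" unfolding G_def by force
      have "c \<noteq> z" using c zA by blast
      moreover have "a < y" "y < c" using yz c unfolding G_def by auto
      ultimately show False using noncrossingD[OF nc A(1) D, of a y c z] a c yz DA by auto
    qed
  qed
  \<comment> \<open>If \<open>A\<close> continues with \<open>c\<close>, compare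
    \<open>c - a\<close> as counted in \<open>B\<close> and in \<open>A\<close>; both are good.
    Otherwise \<open>B\<close> is the disjoint union of \<open>A\<close> and \<open>G\<close>, and
    both \<open>A\<close> and \<open>B\<close> have size congruent to 1.\<close>
  have cardG: "[card G = 0] (mod d)"
  proof (cases "\<exists>c\<in>A. a < c")
    case True
    define c where "c = Min (A \<inter> {a<..})"
    have "c \<in> A \<inter> {a<..}" unfolding c_def using True finA by (intro Min_in) auto
    then have c: "c \<in> A" "a < c" by auto
    have cmin: "c \<le> u" if "u \<in> A" "a < u" for u
      unfolding c_def using that finA by (intro Min_le) auto
    have Geq: "B \<inter> {a..<c} = insert a G"
      using c cmin a AB unfolding G_def by fastforce
    have "a \<notin> G" unfolding G_def by simp
    then have "[c = a + Suc (card G)] (mod d)"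
      using goodD[OF B(1), of a c] c a AB finG unfolding Geq by (auto simp del: add_Suc_right)
    moreover have "A \<inter> {a..<c} = {a}" using cmin c a by fastforce
    then have "[c = a + Suc 0] (mod d)" using goodD[OF ND_memD(1)[OF R A(1)], of a c] c a by auto
    ultimately have "[Suc (card G) = Suc 0] (mod d)"
      by (metis cong_add_lcancel_nat cong_sym cong_trans)
    then show ?thesis by (simp only: cong_Suc_iff)
  next
    case False
    have "B = A \<union> G"
    proof
      show "B \<subseteq> A \<union> G"
      proof
        fix u assume u: "u \<in> B"
        then show "u \<in> A \<union> G" using False below_g[OF u] a g unfolding G_def
          by (cases "a < u") auto
      qed
    qed (use AB GB in auto)
    then have "card B = card A + card G" using finA finG GA card_Un_disjoint by (metis Int_commute)
    moreover have "[card B = 1] (mod d)" "[card A = 1] (mod d)"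
      using B(1) ND_memD(1)[OF R A(1)] unfolding good_def by auto
    ultimately have "[1 + card G = 1 + 0] (mod d)"
      by (metis add.right_neutral cong_add_rcancel_nat cong_sym cong_trans)
    then show ?thesis by (simp only: cong_add_lcancel_nat)
  qed
  let ?Q = "\<lambda>i u. u \<in> insert a G \<and> (i = 0 \<longrightarrow> u = a) \<and>
    [card (B \<inter> {a<..u}) = i] (mod d) \<and> saturated R (B \<inter> {a<..u})"
  let ?r = "\<lambda>u v. u < v \<and> [card (B \<inter> {u<..v}) = 1] (mod d) \<and> saturated R (B \<inter> {u<..v})"
  have Q0: "?Q 0 a" unfolding saturated_def by simp
  have "\<exists>v. ?r u v \<and> ?Q (Suc i) v" if i: "i < d" and Q: "?Q i u" for i u
  proof -
    have au: "a \<le> u" using Q unfolding G_def by auto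
    \<comment> \<open>The congruence in the invariant keeps \<open>G\<close> from being exhausted
      early: that would make \<open>i\<close> congruent to 0 with \<open>i < d\<close>, so
      \<open>i = 0\<close>, yet \<open>g\<close> is still available at the start.\<close>
    have "G \<inter> {u<..} \<noteq> {}"
    proof
      assume e: "G \<inter> {u<..} = {}"
      have "G = B \<inter> {a<..u}"
      proof
        show "G \<subseteq> B \<inter> {a<..u}" using e GB unfolding G_def by (auto simp: not_le[symmetric])
        show "B \<inter> {a<..u} \<subseteq> G" using Q Gdown[of u] by auto
      qed
      then have "[i = 0] (mod d)" using Q cardG cong_sym cong_trans by metis
      then have "i = 0" using i by (simp add: cong_less_modulus_unique_nat)
      then have "u = a" using Q by blast
      then show False using \<open>G = B \<inter> {a<..u}\<close> gG by simp
    qed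
    \<comment> \<open>The next point \<open>m\<close> of \<open>G\<close> opens an outermost block
      \<open>D\<close>, because everything in \<open>B\<close> after \<open>a\<close> and up to
      \<open>u\<close> is already a union of blocks. The end \<open>v\<close> of \<open>D\<close> is
      the next split point.\<close>
    define m where "m = Min (G \<inter> {u<..})"
    have "m \<in> G \<inter> {u<..}" unfolding m_def using \<open>G \<inter> {u<..} \<noteq> {}\<close> finG by (intro Min_in) auto
    then have m: "m \<in> G" "u < m" by auto
    have mle: "m \<le> y" if "y \<in> G" "u < y" for y
      unfolding m_def using that finG by (intro Min_le) auto
    obtain D where D: "D \<in> R" "m \<in> D" using partition_on_obtain[OF part, of m] m GB B(3) by blast
    have DG: "D \<subseteq> G" using saturatedD[OF Gsat D m(1)] .
    have Du: "u < z" if z: "z \<in> D" for z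
    proof (rule ccontr)
      assume "\<not> u < z"
      then have "z \<in> B \<inter> {a<..u}" using z DG GB unfolding G_def by auto
      then have "D \<subseteq> B \<inter> {a<..u}" using Q saturatedD[OF _ D(1) z] by blast
      then show False using D(2) m by auto
    qed
    have finD: "finite D" using DG finG finite_subset by blast
    have MinD: "Min D = m" using finD D Du DG mle by (intro Min_eqI) auto
    define v where "v = Max D"
    have vD: "v \<in> D" unfolding v_def using finD D by (intro Max_in) auto
    have mv: "m \<le> v" unfolding v_def using finD D by simp
    have uv: "u < v" and vG: "v \<in> G" and vB: "v \<in> B" using vD Du DG GB by auto
    have eq: "B \<inter> {u<..v} = B \<inter> {m..v}"
    proof (intro equalityI subsetI)
      fix y assume "y \<in> B \<inter> {u<..v}"
      moreover from this have "y \<in> G" using Gdown[OF vG] au by auto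
      ultimately show "y \<in> B \<inter> {m..v}" using mle by auto
    qed (use m in auto)
    have sat: "saturated R (B \<inter> {u<..v})"
      unfolding saturated_def eq
    proof (intro ballI)
      fix E assume E: "E \<in> R"
      have "z \<in> B \<inter> {m..v}" if "y \<in> E" "y \<in> B \<inter> {m..v}" "z \<in> E" for y z
        using between_Min_Max_closed[OF part nc finD D(1) E that(1,3)] that saturatedD[OF B(2) E that(1)]
        unfolding MinD v_def by auto
      then show "E \<subseteq> B \<inter> {m..v} \<or> E \<inter> (B \<inter> {m..v}) = {}" by blast
    qed
    \<comment> \<open>Goodness of \<open>B\<close> relates \<open>v - m\<close> to the number of
      points of \<open>B\<close>, not just of \<open>D\<close>, in the hull; goodness of
      \<open>D\<close> makes \<open>v - m\<close> congruent to 0.\<close>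
    have "[v = m + card (B \<inter> {m..<v})] (mod d)" using goodD[OF B(1)] m GB vB mv by blast
    moreover have "[v = m] (mod d)"
      using good_Max_Min[OF ND_memD(1)[OF R D(1)] finD] D MinD unfolding v_def by blast
    ultimately have "[m + card (B \<inter> {m..<v}) = m + 0] (mod d)"
      by (metis add.right_neutral cong_sym cong_trans)
    then have "[Suc (card (B \<inter> {m..<v})) = Suc 0] (mod d)"
      by (simp only: cong_Suc_iff cong_add_lcancel_nat)
    moreover have "B \<inter> {m..v} = insert v (B \<inter> {m..<v})" using vB mv by auto
    ultimately have c1: "[card (B \<inter> {u<..v}) = 1] (mod d)" unfolding eq using finB by simp
    have un: "B \<inter> {a<..v} = (B \<inter> {a<..u}) \<union> (B \<inter> {u<..v})" using au uv by auto
    have "card (B \<inter> {a<..v}) = card (B \<inter> {a<..u}) + card (B \<inter> {u<..v})"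
      unfolding un using finB by (intro card_Un_disjoint) auto
    then have "[card (B \<inter> {a<..v}) = i + 1] (mod d)" using Q c1 cong_add by metis
    moreover have "saturated R (B \<inter> {a<..v})"
      using Q sat unfolding un saturated_def by blast
    ultimately show ?thesis using uv c1 sat vG by auto
  qed
  then obtain x where "x 0 = a" "\<forall>i<d. ?r (x i) (x (Suc i))" "\<forall>i\<le>d. ?Q i (x i)"
    by (rule iterate_step[of ?Q a d ?r, OF Q0])
  note x = this
  have "x i \<in> B" if "i \<le> d" for i
    using x(3) that a(1) AB(1) GB by (metis insert_iff subsetD)
  then have "split_points d B x"
    unfolding split_points_def using x(2) by simp
  then show ?thesis using that x by blast
qed

text \<open>Some block of \<open>Q\<close> is not a block of \<open>R\<close>, since otherwise
  \<open>Q\<close> would refine \<open>R\<close>; splitting it along unions of blocks of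
  \<open>R\<close> stays above \<open>R\<close>. This replaces any direct analysis of
  covers.\<close>

theorem exists_split_step:
  assumes R: "R \<in> ND d S" and Q: "Q \<in> ND d S" and fin: "finite S"
    and ref: "refines S R Q" "R \<noteq> Q"
  obtains R' where "split_step d R' Q" "refines S R R'"
proof -
  have partR: "partition_on S R" and partQ: "partition_on S Q" using R Q NDD by auto
  have block: "\<exists>C\<in>Q. D \<subseteq> C" if "D \<in> R" for D using ref(1) that unfolding refines_def by blast
  have "\<not> Q \<subseteq> R"
  proof
    assume "Q \<subseteq> R"
    then have "refines S Q R" using partR partQ unfolding refines_def by blast
    then show False using ref refines_asym by blast
  qed
  then obtain B where B: "B \<in> Q" "B \<notin> R" by blast
  have sat: "saturated R B"
    unfolding saturated_def
  proof (intro ballI)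
    fix D assume "D \<in> R"
    then obtain C where "C \<in> Q" "D \<subseteq> C" using block by blast
    then show "D \<subseteq> B \<or> D \<inter> B = {}" using partition_on_block_eq[OF partQ _ B(1), of C] by blast
  qed
  obtain x where x: "split_points d B x" "\<forall>i<d. saturated R (B \<inter> {x i<..x (Suc i)})"
    using exists_split_points[OF R fin ND_memD(1)[OF Q B(1)] sat ND_memD(2,3)[OF Q B(1)] B(2)] .
  let ?R' = "Q - {B} \<union> set (pieces d B x)"
  have "refines S R ?R'"
    unfolding refines_def
  proof (intro conjI ballI)
    show "partition_on S R" by (fact partR)
    show "partition_on S ?R'" by (rule partition_on_split[OF Q B(1) x(1) fin])
    fix D assume D: "D \<in> R"
    show "\<exists>A\<in>?R'. D \<subseteq> A"
    proof (cases "D \<subseteq> B")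
      case False
      then show ?thesis using block[OF D] by blast
    next
      case True
      show ?thesis
      proof (cases "\<exists>i<d. D \<subseteq> B \<inter> {x i<..x (Suc i)}")
        case False
        then have dis: "D \<inter> (B \<inter> {x i<..x (Suc i)}) = {}" if "i < d" for i
          using x(2) D that unfolding saturated_def by blast
        have "D \<subseteq> B - {x 0<..x d}"
        proof
          fix z assume z: "z \<in> D"
          have "z \<notin> {x 0<..x d}"
          proof
            assume "z \<in> {x 0<..x d}"
            then obtain i where "i < d" "x i < z" "z \<le> x (Suc i)"
              using chain_interval_covered[of x z d] by auto
            then show False using dis[of i] z True by auto
          qed
          then show "z \<in> B - {x 0<..x d}" using z True by blast
        qed
        then show ?thesis unfolding set_pieces by blast
      next
        case True
        then obtain i where "i < d" "D \<subseteq> B \<inter> {x i<..x (Suc i)}" by blast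
        then show ?thesis unfolding set_pieces by blast
      qed
    qed
  qed
  moreover have "split_step d ?R' Q" unfolding split_step_def using B x by blast
  ultimately show ?thesis using that by blast
qed

lemma split_stepD:
  assumes "split_step d R P" "P \<in> ND d S" "finite S"
  shows "R \<in> ND d S" "refines S R P" "card R = card P + d"
proof -
  obtain B x where B: "B \<in> P" "split_points d B x" "R = P - {B} \<union> set (pieces d B x)"
    using assms(1) unfolding split_step_def by blast
  note facts = assms(2) B(1,2) assms(3)
  show "R \<in> ND d S" "refines S R P" "card R = card P + d"
    using split_in_ND[OF facts] refines_split[OF facts] card_split[OF facts] B(3) by simp_all
qed

section \<open>Parking functions on blocks\<close>

text \<open>The net change of the walk over the points of \<open>A\<close>, as an integer because
  the walk goes below 0. As a function of sets it is additive, so pieces need not be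
  intervals.\<close>

definition weight :: "nat \<Rightarrow> nat list \<Rightarrow> nat set \<Rightarrow> int" where
  "weight d as A = int (d * length (filter (\<lambda>z. z \<in> A) as)) - int (card A)"

text \<open>Reading the elements of \<open>B\<close> in increasing order gives a walk with steps
  \<open>d * multiplicity - 1\<close>; the list is parked on \<open>B\<close> if this walk first hits \<open>-1\<close> at its end.\<close>

definition parked :: "nat \<Rightarrow> nat list \<Rightarrow> nat set \<Rightarrow> bool" where
  "parked d as B \<longleftrightarrow> weight d as B = -1 \<and> (\<forall>y\<in>B. 0 \<le> weight d as (B \<inter> {..<y}))"

lemma parkedD:
  "parked d as B \<Longrightarrow> weight d as B = -1"
  "parked d as B \<Longrightarrow> y \<in> B \<Longrightarrow> 0 \<le> weight d as (B \<inter> {..<y})"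
  unfolding parked_def by auto

lemma weight_empty [simp]: "weight d as {} = 0"
  unfolding weight_def by simp

lemma weight_Un:
  assumes "finite A" "finite B" "A \<inter> B = {}"
  shows "weight d as (A \<union> B) = weight d as A + weight d as B"
proof -
  have "length (filter (\<lambda>z. z \<in> A \<union> B) as) =
      length (filter (\<lambda>z. z \<in> A) as) + length (filter (\<lambda>z. z \<in> B) as)"
    using assms(3) by (induction as) auto
  then show ?thesis
    using card_Un_disjoint[OF assms] unfolding weight_def by (simp add: algebra_simps)
qed

lemma weight_snoc: "weight d (as @ [a]) A = weight d as A + (if a \<in> A then int d else 0)"
  unfolding weight_def by (simp add: algebra_simps)

text \<open>One more point lowers the walk by at most 1. This is why a first passage below 0 lands
  exactly on -1.\<close>

lemma weight_insert_ge:
  assumes "finite A"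
  shows "weight d as A - 1 \<le> weight d as (insert y A)"
proof -
  have "length (filter (\<lambda>z. z \<in> A) as) \<le> length (filter (\<lambda>z. z \<in> insert y A) as)"
    by (induction as) auto
  then have "d * length (filter (\<lambda>z. z \<in> A) as) \<le> d * length (filter (\<lambda>z. z \<in> insert y A) as)"
    by (rule mult_le_mono2)
  moreover have "card (insert y A) \<le> Suc (card A)" by (rule card_insert_le_m1) auto
  ultimately show ?thesis unfolding weight_def by linarith
qed

text \<open>Final height -1 makes the size a multiple of \<open>d\<close> plus 1, so first passages
  satisfy the congruence in \<open>split_points\<close> automatically.\<close>

lemma parked_card_cong: "parked d as B \<Longrightarrow> [card B = 1] (mod d)"
proof -
  assume "parked d as B"
  then have "int (card B) = int (d * length (filter (\<lambda>z. z \<in> B) as) + 1)"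
    unfolding parked_def weight_def by simp
  then have "card B = d * length (filter (\<lambda>z. z \<in> B) as) + 1" by (simp only: of_nat_eq_iff)
  moreover have "[d * length (filter (\<lambda>z. z \<in> B) as) + 1 = 0 + 1] (mod d)"
    by (intro cong_add) (simp_all add: cong_0_iff)
  ultimately show ?thesis by simp
qed

section \<open>First passages of the walk\<close>

lemma exists_first_passage:
  assumes fin: "finite G" and neg: "weight d as G \<le> -1"
  obtains m where "m \<in> G" "parked d as (G \<inter> {..m})"
proof -
  define N where "N = {y \<in> G. weight d as (G \<inter> {..y}) < 0}"
  have "G \<noteq> {}" using neg by auto
  then have "Max G \<in> G" "G \<inter> {..Max G} = G" using fin by auto
  then have "Max G \<in> N" unfolding N_def using neg by simp
  then have "N \<noteq> {}" "finite N" unfolding N_def using fin by auto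
  then have mN: "Min N \<in> N" by simp
  define m where "m = Min N"
  have m: "m \<in> G" "weight d as (G \<inter> {..m}) < 0" using mN unfolding m_def N_def by auto
  \<comment> \<open>\<open>y\<close> need not lie in \<open>G\<close>; the largest point
    \<open>z\<close> of \<open>G\<close> below it yields the same initial segment.\<close>
  have before: "0 \<le> weight d as (G \<inter> {..<y})" if "y \<le> m" for y
  proof (cases "G \<inter> {..<y} = {}")
    case False
    define z where "z = Max (G \<inter> {..<y})"
    have "z \<in> G \<inter> {..<y}" unfolding z_def using False fin by (intro Max_in) auto
    then have z: "z \<in> G" "z < y" by auto
    have zmax: "u \<le> z" if "u \<in> G" "u < y" for u
      unfolding z_def using that fin by (intro Max_ge) auto
    have "G \<inter> {..<y} = G \<inter> {..z}" using z zmax by auto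
    moreover have "z \<notin> N"
    proof
      assume "z \<in> N"
      then have "m \<le> z" unfolding m_def using \<open>finite N\<close> by (intro Min_le)
      then show False using z that by simp
    qed
    ultimately show ?thesis using z unfolding N_def by auto
  qed simp
  have "G \<inter> {..m} = insert m (G \<inter> {..<m})" using m by auto
  then have "weight d as (G \<inter> {..m}) = -1"
    using weight_insert_ge[of "G \<inter> {..<m}" d as m] before[of m] m fin by simp
  moreover have "0 \<le> weight d as (G \<inter> {..m} \<inter> {..<y})" if "y \<in> G \<inter> {..m}" for y
  proof -
    have "G \<inter> {..m} \<inter> {..<y} = G \<inter> {..<y}" using that by auto
    then show ?thesis using before that by simp
  qed
  ultimately show ?thesis using that[of m] m unfolding parked_def by blast
qed

text \<open>If \<open>m < m'\<close>, then at the successor of \<open>m\<close> in \<open>G\<close>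
  the walk has already reached -1, which parking up to \<open>m'\<close> forbids. Used in both
  directions for uniqueness.\<close>

lemma first_passage_le:
  assumes fin: "finite G" and "m \<in> G" "m' \<in> G"
    and p: "parked d as (G \<inter> {..m})" and p': "parked d as (G \<inter> {..m'})"
  shows "m' \<le> m"
proof (rule ccontr)
  assume "\<not> m' \<le> m"
  then have m': "m' \<in> G \<inter> {m<..}" using assms by auto
  define y where "y = Min (G \<inter> {m<..})"
  have "y \<in> G \<inter> {m<..}" unfolding y_def using m' fin by (intro Min_in) auto
  moreover have ymin: "y \<le> u" if "u \<in> G" "m < u" for u
    unfolding y_def using that fin by (intro Min_le) auto
  ultimately have y: "y \<in> G \<inter> {..m'}" "m < y" using m' by auto
  have "G \<inter> {..m'} \<inter> {..<y} = G \<inter> {..m}"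
  proof (intro equalityI subsetI)
    fix u assume "u \<in> G \<inter> {..m'} \<inter> {..<y}"
    then show "u \<in> G \<inter> {..m}" using ymin[of u] by (cases "m < u") auto
  qed (use y in auto)
  then have "0 \<le> weight d as (G \<inter> {..m})" using parkedD(2)[OF p' y(1)] by simp
  then show False using parkedD(1)[OF p] by simp
qed

lemma weight_split_interval:
  assumes "finite B" "u \<le> v" "v \<le> w"
  shows "weight d as (B \<inter> {u<..w}) = weight d as (B \<inter> {u<..v}) + weight d as (B \<inter> {v<..w})"
proof -
  have "B \<inter> {u<..w} = (B \<inter> {u<..v}) \<union> (B \<inter> {v<..w})" using assms by auto
  moreover have "(B \<inter> {u<..v}) \<inter> (B \<inter> {v<..w}) = {}" by auto
  ultimately show ?thesis using assms(1) weight_Un[of "B \<inter> {u<..v}" "B \<inter> {v<..w}" d as] by simp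
qed

lemma weight_pieces_interval:
  assumes fin: "finite B" and mono: "\<And>i. i < d \<Longrightarrow> x i < x (Suc i)"
    and w: "\<And>i. i < d \<Longrightarrow> weight d as (B \<inter> {x i<..x (Suc i)}) = -1"
  shows "i \<le> d \<Longrightarrow> weight d as (B \<inter> {x 0<..x i}) = - int i"
proof (induction i)
  case (Suc i)
  have "x 0 \<le> x i" "x i \<le> x (Suc i)"
    using chain_mono[of d x 0 i, OF mono] less_imp_le[OF mono[of i]] Suc.prems by auto
  then show ?case
    using weight_split_interval[OF fin, of "x 0" "x i" "x (Suc i)" d as] Suc w[of i] by simp
qed simp

text \<open>Up to \<open>x 0\<close> the walk on \<open>B\<close> agrees with that of the outer
  piece. The new label raises it by \<open>d\<close>, each interval piece lowers it by 1 in total,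
  and beyond \<open>x d\<close> it has returned to the walk of the outer piece.\<close>

lemma parked_merge:
  assumes x: "split_points d B x" and fin: "finite B"
    and p: "\<And>A. A \<in> set (pieces d B x) \<Longrightarrow> parked d as A"
  shows "parked d (as @ [x 0]) B"
proof -
  let ?A = "B - {x 0<..x d}" and ?w = "weight d as"
  have pA: "parked d as ?A" using p unfolding set_pieces by blast
  have pI: "parked d as (B \<inter> {x i<..x (Suc i)})" if "i < d" for i
    using p that unfolding set_pieces by blast
  have wI: "?w (B \<inter> {x 0<..x i}) = - int i" if "i \<le> d" for i
    using split_pointsD(2)[OF x] parkedD(1)[OF pI] that by (rule weight_pieces_interval[OF fin])
  have x0: "x 0 \<in> B" using split_pointsD(1)[OF x] by simp
  have split: "?w (B \<inter> U) = ?w (?A \<inter> U) + ?w (B \<inter> {x 0<..x d})" if "{x 0<..x d} \<subseteq> U" for U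
  proof -
    have "B \<inter> U = (?A \<inter> U) \<union> (B \<inter> {x 0<..x d})" using that by blast
    then show ?thesis using weight_Un[of "?A \<inter> U" "B \<inter> {x 0<..x d}" d as] fin by auto
  qed
  have "?w B = -1 - int d" using split[of UNIV] wI[of d] parkedD(1)[OF pA] by simp
  then have "weight d (as @ [x 0]) B = -1" using x0 unfolding weight_snoc by simp
  moreover have "0 \<le> weight d (as @ [x 0]) (B \<inter> {..<y})" if y: "y \<in> B" for y
  proof -
    consider "y \<le> x 0" | "x 0 < y" "y \<le> x d" | "x 0 < y" "x d < y" by linarith
    then show ?thesis
    proof cases
      case 1
      then have "B \<inter> {..<y} = ?A \<inter> {..<y}" by auto
      then show ?thesis using parkedD(2)[OF pA, of y] y 1 unfolding weight_snoc by auto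
    next
      case 2
      then obtain i where i: "i < d" "x i < y" "y \<le> x (Suc i)"
        using chain_interval_covered[of x y d] by auto
      have mono: "x 0 \<le> x i" using split_pointsD(4)[OF x, of 0 i] i by simp
      have "?A \<inter> {..<x 0} = B \<inter> {..<x 0}" by auto
      then have "0 \<le> ?w (B \<inter> {..<x 0})" using parkedD(2)[OF pA, of "x 0"] x0 by simp
      moreover have "insert (x 0) (B \<inter> {..<x 0}) = B \<inter> {..x 0}" using x0 by auto
      ultimately have 3: "-1 \<le> ?w (B \<inter> {..x 0})"
        using weight_insert_ge[of "B \<inter> {..<x 0}" d as "x 0"] fin by simp
      have "0 \<le> ?w (B \<inter> {x i<..x (Suc i)} \<inter> {..<y})"
        using parkedD(2)[OF pI[OF i(1)], of y] y i by simp
      moreover have "?w (B \<inter> {..<y}) = ?w ((B \<inter> {..x 0}) \<union> (B \<inter> {x 0<..x i})) + ?w (B \<inter> {x i<..x (Suc i)} \<inter> {..<y})"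
      proof (subst weight_Un[symmetric])
        show "(B \<inter> {..x 0} \<union> B \<inter> {x 0<..x i}) \<inter> (B \<inter> {x i<..x (Suc i)} \<inter> {..<y}) = {}"
          using mono by auto
        have "u \<in> {..<y} \<longleftrightarrow> u \<le> x 0 \<or> x 0 < u \<and> u \<le> x i \<or> x i < u \<and> u \<le> x (Suc i) \<and> u < y" for u
          unfolding lessThan_iff using i mono by linarith
        then have "B \<inter> {..<y} = B \<inter> {..x 0} \<union> B \<inter> {x 0<..x i} \<union> B \<inter> {x i<..x (Suc i)} \<inter> {..<y}"
          by (intro set_eqI) (simp only: Un_iff Int_iff atMost_iff greaterThanAtMost_iff, blast)
        then show "?w (B \<inter> {..<y}) = ?w (B \<inter> {..x 0} \<union> B \<inter> {x 0<..x i} \<union> B \<inter> {x i<..x (Suc i)} \<inter> {..<y})"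
          by (rule arg_cong)
      qed (use fin in auto)
      moreover have "?w ((B \<inter> {..x 0}) \<union> (B \<inter> {x 0<..x i})) = ?w (B \<inter> {..x 0}) + ?w (B \<inter> {x 0<..x i})"
        using fin by (intro weight_Un) auto
      \<comment> \<open>Since \<open>i < d\<close>, the \<open>d\<close> contributed by the appended
        label makes this bound nonnegative.\<close>
      ultimately have "-1 - int i \<le> ?w (B \<inter> {..<y})" using 3 wI[of i] i(1) by linarith
      moreover have "x 0 \<in> B \<inter> {..<y}" using x0 2 by simp
      ultimately show ?thesis using i(1) unfolding weight_snoc by simp
    next
      case 3
      then have "{x 0<..x d} \<subseteq> {..<y}" by auto
      then have "?w (B \<inter> {..<y}) = ?w (?A \<inter> {..<y}) - int d"
        using split[of "{..<y}"] wI[of d] by simp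
      moreover have "0 \<le> ?w (?A \<inter> {..<y})" using parkedD(2)[OF pA, of y] y 3 by auto
      ultimately show ?thesis using 3 x0 unfolding weight_snoc by auto
    qed
  qed
  ultimately show ?thesis unfolding parked_def by blast
qed

lemma exists_parked_split:
  assumes p: "parked d (as @ [a]) B" and a: "a \<in> B" and fin: "finite B"
  obtains x where "split_points d B x" "x 0 = a" "\<forall>A\<in>set (pieces d B x). parked d as A"
proof -
  let ?w = "weight d as"
  have wB: "?w B = -1 - int d" using parkedD(1)[OF p] a unfolding weight_snoc by simp
  have "a \<notin> B \<inter> {..<a}" by simp
  then have "0 \<le> ?w (B \<inter> {..<a})" using parkedD(2)[OF p a] unfolding weight_snoc by simp
  moreover have "insert a (B \<inter> {..<a}) = B \<inter> {..a}" using a by auto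
  ultimately have "-1 \<le> ?w (B \<inter> {..a})"
    using weight_insert_ge[of "B \<inter> {..<a}" d as a] fin by simp
  moreover have "(B \<inter> {..a}) \<union> (B \<inter> {a<..}) = B" "(B \<inter> {..a}) \<inter> (B \<inter> {a<..}) = {}" by auto
  then have "?w B = ?w (B \<inter> {..a}) + ?w (B \<inter> {a<..})"
    using weight_Un[of "B \<inter> {..a}" "B \<inter> {a<..}" d as] fin by simp
  \<comment> \<open>Without the last label the total is \<open>-1 - d\<close>, of which at most one
    level is lost up to \<open>a\<close>. So there are at least \<open>d\<close> levels to descend
    after \<open>a\<close>, one for each first passage.\<close>
  ultimately have start: "?w (B \<inter> {a<..}) \<le> - int d" using wB by simp
  let ?Q = "\<lambda>i u. u \<in> B \<and> ?w (B \<inter> {u<..}) \<le> int i - int d"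
  let ?r = "\<lambda>u v. u < v \<and> parked d as (B \<inter> {u<..v})"
  have Q0: "?Q 0 a" using a start by simp
  have "\<exists>v. ?r u v \<and> ?Q (Suc i) v" if "i < d" "?Q i u" for i u
  proof -
    have "finite (B \<inter> {u<..})" "?w (B \<inter> {u<..}) \<le> -1" using that fin by auto
    then obtain v where v: "v \<in> B \<inter> {u<..}" "parked d as (B \<inter> {u<..} \<inter> {..v})"
      by (rule exists_first_passage)
    have eq: "B \<inter> {u<..} \<inter> {..v} = B \<inter> {u<..v}" by auto
    have "(B \<inter> {u<..v}) \<union> (B \<inter> {v<..}) = B \<inter> {u<..}" "(B \<inter> {u<..v}) \<inter> (B \<inter> {v<..}) = {}"
      using v by auto
    then have "?w (B \<inter> {u<..}) = ?w (B \<inter> {u<..v}) + ?w (B \<inter> {v<..})"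
      using weight_Un[of "B \<inter> {u<..v}" "B \<inter> {v<..}" d as] fin by simp
    moreover have "parked d as (B \<inter> {u<..v})" using v(2) unfolding eq .
    ultimately have "?w (B \<inter> {v<..}) \<le> int (Suc i) - int d"
      using parkedD(1)[of d as "B \<inter> {u<..v}"] that(2) by linarith
    then show ?thesis using v(1) \<open>parked d as (B \<inter> {u<..v})\<close> by blast
  qed
  then obtain x where x: "x 0 = a" "\<forall>i<d. ?r (x i) (x (Suc i))" "\<forall>i\<le>d. ?Q i (x i)"
    by (rule iterate_step[of ?Q a d ?r, OF Q0])
  have sp: "split_points d B x"
    unfolding split_points_def using x parked_card_cong by blast
  have wI: "?w (B \<inter> {x 0<..x d}) = - int d"
    using x parkedD(1) by (intro weight_pieces_interval[OF fin]) auto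
  let ?A = "B - {x 0<..x d}"
  \<comment> \<open>Deleting the interval pieces raises the old walk by \<open>d\<close>, the same
    amount that the missing label would have added; so the outer piece inherits its bounds from
    \<open>as @ [a]\<close> on \<open>B\<close>.\<close>
  have split: "?w (B \<inter> U) = ?w (?A \<inter> U) - int d" if "{x 0<..x d} \<subseteq> U" for U
  proof -
    have "B \<inter> U = (?A \<inter> U) \<union> (B \<inter> {x 0<..x d})" using that by blast
    then show ?thesis using weight_Un[of "?A \<inter> U" "B \<inter> {x 0<..x d}" d as] fin wI by auto
  qed
  have "?w ?A = -1" using split[of UNIV] wB by simp
  moreover have "0 \<le> ?w (?A \<inter> {..<y})" if y: "y \<in> ?A" for y
  proof (cases "y \<le> x 0")
    case True
    then have "?A \<inter> {..<y} = B \<inter> {..<y}" by auto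
    then show ?thesis using parkedD(2)[OF p, of y] y True x(1) unfolding weight_snoc by auto
  next
    case False
    then have "{x 0<..x d} \<subseteq> {..<y}" using y by auto
    then show ?thesis using parkedD(2)[OF p, of y] y split[of "{..<y}"] False x(1)
      unfolding weight_snoc by (auto split: if_splits)
  qed
  ultimately have "parked d as ?A" unfolding parked_def by blast
  then show ?thesis using that[of x] sp x unfolding set_pieces by auto
qed

text \<open>Each \<open>x (Suc i)\<close> must be the first passage after \<open>x i\<close>. The
  conclusion concerns pieces because \<open>x\<close> is arbitrary beyond \<open>d\<close>.\<close>

lemma parked_split_unique:
  assumes x: "split_points d B x" and x': "split_points d B x'" and x0: "x 0 = x' 0" and fin: "finite B"
    and p: "\<forall>A\<in>set (pieces d B x). parked d as A" and p': "\<forall>A\<in>set (pieces d B x'). parked d as A"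
  shows "pieces d B x = pieces d B x'"
proof -
  have eq: "x i = x' i" if "i \<le> d" for i
    using that
  proof (induction i)
    case (Suc i)
    let ?G = "B \<inter> {x i<..}"
    have u: "x i = x' i" using Suc by simp
    have G: "?G \<inter> {..v} = B \<inter> {x i<..v}" for v by auto
    have "x (Suc i) \<in> ?G" "x' (Suc i) \<in> ?G"
      using split_pointsD(1)[OF x, of "Suc i"] split_pointsD(2)[OF x, of i]
        split_pointsD(1)[OF x', of "Suc i"] split_pointsD(2)[OF x', of i] Suc.prems u by auto
    moreover have "B \<inter> {x i<..x (Suc i)} \<in> set (pieces d B x)"
      "B \<inter> {x' i<..x' (Suc i)} \<in> set (pieces d B x')"
      using Suc.prems unfolding set_pieces by auto
    then have "parked d as (?G \<inter> {..x (Suc i)})" "parked d as (?G \<inter> {..x' (Suc i)})"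
      using p p' u unfolding G by auto
    ultimately show ?case using first_passage_le[of ?G _ _ d as] fin by (simp add: order_antisym)
  qed (use x0 in simp)
  then show ?thesis unfolding pieces_def by simp
qed

lemma split_step_parked:
  assumes step: "split_step d R P" and P: "P \<in> ND d S" and fin: "finite S" and d: "1 \<le> d"
    and p: "\<forall>A\<in>R. parked d as A"
  shows "edge_label R P \<in> S" "\<forall>A\<in>P. parked d (as @ [edge_label R P]) A"
proof -
  obtain B x where B: "B \<in> P" "split_points d B x" "R = P - {B} \<union> set (pieces d B x)"
    using step unfolding split_step_def by blast
  have lab: "edge_label R P = x 0" using edge_label_split[OF P B(1,2) fin d] B(3) by simp
  have x0: "x 0 \<in> B" using split_pointsD(1)[OF B(2)] by simp
  have finB: "finite B" using ND_memD(2)[OF P B(1)] fin finite_subset by blast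
  show "edge_label R P \<in> S" using lab x0 ND_memD(2)[OF P B(1)] by auto
  show "\<forall>A\<in>P. parked d (as @ [edge_label R P]) A"
  proof
    fix A assume A: "A \<in> P"
    show "parked d (as @ [edge_label R P]) A"
    proof (cases "A = B")
      case True
      then show ?thesis using parked_merge[OF B(2) finB] p B(3) lab by simp
    next
      case False
      then have "x 0 \<notin> A" using partition_on_block_eq[OF NDD(1)[OF P] A B(1)] x0 by blast
      moreover have "parked d as A" using p B(3) A False by blast
      ultimately show ?thesis unfolding lab parked_def weight_snoc by simp
    qed
  qed
qed

text \<open>The label names the block to split, as it lies in only one block, and the other blocks
  do not notice its removal from the list.\<close>

lemma ex1_parked_split_step:
  assumes P: "P \<in> ND d S" and fin: "finite S" and d: "1 \<le> d"
    and p: "\<forall>A\<in>P. parked d (as @ [a]) A" and a: "a \<in> S"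
  shows "\<exists>!R. split_step d R P \<and> edge_label R P = a \<and> (\<forall>A\<in>R. parked d as A)"
proof -
  obtain B where B: "B \<in> P" "a \<in> B" using partition_on_obtain[OF NDD(1)[OF P] a] .
  have finB: "finite B" using ND_memD(2)[OF P B(1)] fin finite_subset by blast
  obtain x where x: "split_points d B x" "x 0 = a" "\<forall>A\<in>set (pieces d B x). parked d as A"
    using exists_parked_split[OF bspec[OF p B(1)] B(2) finB] .
  let ?R = "P - {B} \<union> set (pieces d B x)"
  have other: "parked d as A" if "A \<in> P" "A \<noteq> B" for A
  proof -
    have "a \<notin> A" using partition_on_block_eq[OF NDD(1)[OF P] that(1) B(1)] that B(2) by blast
    then show ?thesis using bspec[OF p that(1)] unfolding parked_def weight_snoc by simp
  qed
  show ?thesis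
  proof (rule ex1I[of _ ?R])
    have "split_step d ?R P" unfolding split_step_def using B x by blast
    then show "split_step d ?R P \<and> edge_label ?R P = a \<and> (\<forall>A\<in>?R. parked d as A)"
      using other x edge_label_split[OF P B(1) x(1) fin d] by auto
  next
    fix R assume R: "split_step d R P \<and> edge_label R P = a \<and> (\<forall>A\<in>R. parked d as A)"
    then obtain B' x' where B': "B' \<in> P" "split_points d B' x'" "R = P - {B'} \<union> set (pieces d B' x')"
      unfolding split_step_def by blast
    have x'0: "x' 0 = a" using edge_label_split[OF P B'(1,2) fin d] B'(3) R by simp
    then have "a \<in> B'" using split_pointsD(1)[OF B'(2), of 0] by simp
    then have "B' = B" using partition_on_block_eq[OF NDD(1)[OF P] B'(1) B(1)] B(2) by blast
    moreover have "\<forall>A\<in>set (pieces d B' x'). parked d as A" using R B'(3) by blast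
    ultimately have "pieces d B x' = pieces d B x"
      using parked_split_unique[of d B x' x as] B'(2) x x'0 finB by simp
    then show "R = ?R" using B'(3) \<open>B' = B\<close> by simp
  qed
qed

section \<open>Labels of split chains\<close>

text \<open>Chains run from the singletons upwards and may end anywhere, which the induction on
  labels needs. Membership of \<open>P\<close> is demanded explicitly because a split passes
  goodness only from the coarser partition to the finer one.\<close>

inductive split_chain :: "nat \<Rightarrow> nat set \<Rightarrow> nat set set list \<Rightarrow> bool" for d S where
  base: "split_chain d S [(\<lambda>x. {x}) ` S]"
| snoc: "split_chain d S ps \<Longrightarrow> P \<in> ND d S \<Longrightarrow> split_step d (last ps) P \<Longrightarrow> split_chain d S (ps @ [P])"

definition labels :: "nat set set list \<Rightarrow> nat list" where
  "labels ps = map2 edge_label ps (tl ps)"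

lemma labels_snoc: "ps \<noteq> [] \<Longrightarrow> labels (ps @ [P]) = labels ps @ [edge_label (last ps) P]"
proof (induction ps)
  case (Cons Q ps)
  then show ?case by (cases ps) (auto simp: labels_def)
qed simp

lemma singletons_in_ND: "(\<lambda>x. {x}) ` S \<in> ND d S"
  unfolding ND_def noncrossing_def good_def using partition_on_singletons by auto

lemma split_chain_nonempty: "split_chain d S ps \<Longrightarrow> ps \<noteq> []"
  by (cases rule: split_chain.cases) auto

lemma split_chain_subset_ND: "split_chain d S ps \<Longrightarrow> set ps \<subseteq> ND d S"
  by (induction rule: split_chain.induct) (auto simp: singletons_in_ND)

lemma split_chain_labels:
  assumes "finite S" "1 \<le> d" "split_chain d S ps"
  shows "set (labels ps) \<subseteq> S \<and> (\<forall>B\<in>last ps. parked d (labels ps) B)"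
  using assms(3)
proof (induction rule: split_chain.induct)
  case base
  then show ?case by (auto simp: labels_def parked_def weight_def)
next
  case (snoc ps P)
  then show ?case
    using split_step_parked[of d "last ps" P S "labels ps"] assms(1,2)
    by (simp add: labels_snoc split_chain_nonempty)
qed

lemma parked_Nil_singletons:
  assumes P: "partition_on S P" and p: "\<forall>B\<in>P. parked d [] B"
  shows "P = (\<lambda>x. {x}) ` S"
proof -
  have single: "B = {x}" if "B \<in> P" "x \<in> B" for B x
  proof -
    have "card B = 1" using p that(1) unfolding parked_def weight_def by force
    then show ?thesis using that(2) card_1_singletonE by blast
  qed
  show ?thesis
  proof (intro equalityI subsetI)
    fix B assume B: "B \<in> P"
    then obtain x where "x \<in> B" "x \<in> S" using partition_on_memD[OF P B] by blast
    then show "B \<in> (\<lambda>x. {x}) ` S" using single[OF B] by blast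
  next
    fix B assume "B \<in> (\<lambda>x. {x}) ` S"
    then obtain x where x: "x \<in> S" "B = {x}" by blast
    then obtain C where "C \<in> P" "x \<in> C" using partition_on_obtain[OF P] by blast
    then show "B \<in> P" using single x by blast
  qed
qed

text \<open>The last label determines the partition just below the top, whose blocks are again
  parked, now by the shorter list; hence the generalisation to an arbitrary top
  \<open>P\<close>.\<close>

lemma ex1_split_chain:
  assumes fin: "finite S" and d: "1 \<le> d"
  shows "P \<in> ND d S \<Longrightarrow> set as \<subseteq> S \<Longrightarrow> \<forall>B\<in>P. parked d as B \<Longrightarrow>
    \<exists>!ps. split_chain d S ps \<and> last ps = P \<and> labels ps = as"
proof (induction as arbitrary: P rule: rev_induct)
  case Nil
  have P: "P = (\<lambda>x. {x}) ` S" using parked_Nil_singletons[OF NDD(1)[OF Nil(1)] Nil(3)] .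
  show ?case
  proof (rule ex1I[of _ "[P]"])
    show "split_chain d S [P] \<and> last [P] = P \<and> labels [P] = []"
      unfolding P using base by (simp add: labels_def)
    fix ps assume "split_chain d S ps \<and> last ps = P \<and> labels ps = []"
    then have "split_chain d S ps" "labels ps = []" by auto
    then show "ps = [P]"
      using split_chain_nonempty by (cases rule: split_chain.cases) (auto simp: P labels_snoc)
  qed
next
  case (snoc a as)
  have a: "a \<in> S" "set as \<subseteq> S" using snoc.prems(2) by auto
  from ex1_parked_split_step[OF snoc.prems(1) fin d snoc.prems(3) a(1)]
  obtain R where R': "split_step d R P \<and> edge_label R P = a \<and> (\<forall>B\<in>R. parked d as B)"
    and R_uniq: "\<forall>R'. split_step d R' P \<and> edge_label R' P = a \<and> (\<forall>B\<in>R'. parked d as B) \<longrightarrow> R' = R"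
    by (rule ex1E)
  then have R: "split_step d R P" "edge_label R P = a" "\<forall>B\<in>R. parked d as B" by blast+
  have "R \<in> ND d S" using split_stepD(1)[OF R(1) snoc.prems(1) fin] .
  from snoc.IH[OF this a(2) R(3)]
  obtain ps where ps: "split_chain d S ps \<and> last ps = R \<and> labels ps = as"
    and ps_uniq: "\<forall>qs. split_chain d S qs \<and> last qs = R \<and> labels qs = as \<longrightarrow> qs = ps"
    by (rule ex1E)
  show ?case
  proof (rule ex1I[of _ "ps @ [P]"])
    show "split_chain d S (ps @ [P]) \<and> last (ps @ [P]) = P \<and> labels (ps @ [P]) = as @ [a]"
      using ps R snoc.prems(1) split_chain.snoc[of d S ps P] split_chain_nonempty[of d S ps] by (simp add: labels_snoc)
    fix qs assume qs: "split_chain d S qs \<and> last qs = P \<and> labels qs = as @ [a]"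
    then have "split_chain d S qs" by blast
    then show "qs = ps @ [P]"
    proof (cases rule: split_chain.cases)
      case base
      then show ?thesis using qs by (simp add: labels_def)
    next
      case (snoc qs' P')
      have ne: "qs' \<noteq> []" using snoc split_chain_nonempty by blast
      have 1: "P' = P" "labels qs' = as" "edge_label (last qs') P = a"
        using qs snoc ne by (auto simp: labels_snoc)
      \<comment> \<open>A competing chain qualifies for the uniqueness of \<open>R\<close> because
        its own labels are parked on all blocks of its last partition.\<close>
      then have "last qs' = R"
        using R_uniq[rule_format, of "last qs'"] snoc split_chain_labels[OF fin d, of qs'] by blast
      then show ?thesis using ps_uniq[rule_format, of qs'] snoc 1 by blast
    qed
  qed
qed

section \<open>Parking on the full interval versus the sorted inequalities\<close>

lemma sorted_nth_less_iff:
  assumes "sorted xs" "i < length xs"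
  shows "xs ! i < (y :: 'a :: linorder) \<longleftrightarrow> i < length (filter (\<lambda>z. z < y) xs)"
  using assms
proof (induction xs arbitrary: i)
  case (Cons x xs)
  show ?case
  proof (cases "x < y")
    case True
    then show ?thesis using Cons by (cases i) auto
  next
    case False
    then have "filter (\<lambda>z. z < y) (x # xs) = []" using Cons.prems(1) by (auto simp: filter_empty_conv)
    moreover have "x \<le> (x # xs) ! i" using Cons.prems by (cases i) auto
    ultimately show ?thesis using False by auto
  qed
qed simp

lemma parking_functions_iff_parked:
  assumes d: "1 \<le> d"
  shows "as \<in> parking_functions d k \<longleftrightarrow> set as \<subseteq> {1..d * k + 1} \<and> parked d as {1..d * k + 1}"
    (is "_ \<longleftrightarrow> set as \<subseteq> ?S \<and> _")
proof -
  define cnt where "cnt y = length (filter (\<lambda>z. z < y) as)" for y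
  have nth_less: "sort as ! i < y \<longleftrightarrow> i < cnt y" if "i < length as" for i y
  proof -
    have "length (filter (\<lambda>z. z < y) (sort as)) = length (filter (\<lambda>z. z < y) as)"
      by (metis mset_filter mset_sort size_mset)
    then show ?thesis using sorted_nth_less_iff[of "sort as" i y] that unfolding cnt_def by simp
  qed
  have weight_S: "weight d as ?S = int (d * length as) - int (d * k + 1)" if "set as \<subseteq> ?S"
  proof -
    have "filter (\<lambda>z. z \<in> ?S) as = as" using that by (intro filter_True) auto
    then show ?thesis unfolding weight_def by simp
  qed
  have weight_less: "0 \<le> weight d as (?S \<inter> {..<y}) \<longleftrightarrow> y \<le> d * cnt y + 1"
    if "set as \<subseteq> ?S" "y \<in> ?S" for y
  proof -
    have f: "filter (\<lambda>z. z \<in> ?S \<inter> {..<y}) as = filter (\<lambda>z. z < y) as"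
      using that(1) by (intro filter_cong) auto
    have "?S \<inter> {..<y} = {1..<y}" using that(2) by auto
    then have "card (?S \<inter> {..<y}) = y - 1" by simp
    with f have "weight d as (?S \<inter> {..<y}) = int (d * cnt y) - int (y - 1)"
      unfolding weight_def cnt_def by (simp only:)
    then show ?thesis using that(2) by (simp only: atLeastAtMost_iff) linarith
  qed
  show ?thesis
  proof
    assume pf: "as \<in> parking_functions d k"
    then have len: "length as = k" and pos: "\<forall>x\<in>set as. 0 < x"
      and bound: "\<And>i. i < k \<Longrightarrow> sort as ! i \<le> d * i + 1"
      unfolding parking_functions_def by auto
    have sub: "set as \<subseteq> ?S"
    proof
      fix x assume x: "x \<in> set as"
      then obtain i where i: "i < k" "x = sort as ! i"
        using len by (metis in_set_conv_nth length_sort set_sort)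
      then have "x \<le> d * i + 1" using bound by simp
      also have "\<dots> \<le> d * k + 1" using i by simp
      finally show "x \<in> ?S" using pos x by (auto simp: Suc_le_eq)
    qed
    have "y \<le> d * cnt y + 1" if y: "y \<in> ?S" for y
    proof (cases "cnt y < k")
      \<comment> \<open>The sorted entry with index \<open>cnt y\<close> is the first one that is at
        least \<open>y\<close>, so its bound is also a bound for \<open>y\<close>.\<close>
      case True
      then have "y \<le> sort as ! cnt y" using nth_less[of "cnt y" y] len by simp
      then show ?thesis using bound[OF True] by simp
    next
      case False
      then have "d * k \<le> d * cnt y" by (intro mult_le_mono2) simp
      then show ?thesis using y unfolding atLeastAtMost_iff by linarith
    qed
    then have "parked d as ?S"
      unfolding parked_def using weight_S[OF sub] weight_less[OF sub] len by simp
    then show "set as \<subseteq> ?S \<and> parked d as ?S" using sub by blast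
  next
    assume "set as \<subseteq> ?S \<and> parked d as ?S"
    then have sub: "set as \<subseteq> ?S" and p: "parked d as ?S" by auto
    have "int (d * length as) = int (d * k)" using weight_S[OF sub] parkedD(1)[OF p] by simp
    then have len: "length as = k" using d by (simp only: of_nat_eq_iff) simp
    have "sort as ! i \<le> d * i + 1" if i: "i < k" for i
    proof (rule ccontr)
      \<comment> \<open>The least value violating the bound at index \<open>i\<close>: at most
        \<open>i\<close> entries lie below it, so the walk is negative just before
        \<open>y\<close>.\<close>
      define y where "y = d * i + 2"
      assume "\<not> sort as ! i \<le> d * i + 1"
      then have "\<not> sort as ! i < y" unfolding y_def by simp
      then have "cnt y \<le> i" using nth_less[of i y] i len by simp
      then have "d * cnt y \<le> d * i" by simp
      have "d * Suc i \<le> d * k" using i by (intro mult_le_mono2) simp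
      then have "y \<in> ?S" unfolding y_def using d by simp
      then have "y \<le> d * cnt y + 1" using weight_less[OF sub] parkedD(2)[OF p] by blast
      then show False using \<open>d * cnt y \<le> d * i\<close> y_def by linarith
    qed
    moreover have "\<forall>x\<in>set as. 0 < x" using sub by (auto simp: subset_iff Suc_le_eq)
    ultimately show "as \<in> parking_functions d k" unfolding parking_functions_def using len by simp
  qed
qed

section \<open>Maximal chains\<close>

lemma sorted_wrt_unique:
  assumes "\<And>x y. r x y \<Longrightarrow> \<not> r y x"
  shows "sorted_wrt r xs \<Longrightarrow> sorted_wrt r ys \<Longrightarrow> set xs = set ys \<Longrightarrow> xs = ys"
proof (induction xs arbitrary: ys)
  case (Cons x xs)
  then obtain y ys' where ys: "ys = y # ys'" by (cases ys) auto
  have eq: "insert x (set xs) = insert y (set ys')" using Cons.prems(3) unfolding ys by simp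
  have less: "\<forall>z\<in>set xs. r x z" "\<forall>z\<in>set ys'. r y z" using Cons.prems unfolding ys by auto
  have xy: "x = y"
  proof (rule ccontr)
    assume "x \<noteq> y"
    then have "x \<in> set ys'" "y \<in> set xs" using eq by (metis insertE insertI1)+
    then have "r x y" "r y x" using less by simp_all
    then show False using assms by simp
  qed
  have "\<not> r z z" for z using assms[of z z] by blast
  then have "x \<notin> set xs" "y \<notin> set ys'" using less by auto
  then have "set xs = set ys'" using eq xy by (simp add: insert_ident)
  then show ?case using Cons xy unfolding ys by simp
qed simp

lemma finite_total_sorted_list:
  assumes trans: "\<And>x y z. r x y \<Longrightarrow> r y z \<Longrightarrow> r x z" and "finite C"
    and "\<And>x y. x \<in> C \<Longrightarrow> y \<in> C \<Longrightarrow> x = y \<or> r x y \<or> r y x"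
  shows "\<exists>ps. sorted_wrt r ps \<and> set ps = C"
  using assms(2,3)
proof (induction C rule: finite_induct)
  case (insert x C)
  then obtain ps where ps: "sorted_wrt r ps" "set ps = C" by blast
  let ?qs = "filter (\<lambda>y. r y x) ps @ x # filter (\<lambda>y. \<not> r y x) ps"
  have after: "r x y" if "y \<in> C" "\<not> r y x" for y
    using insert.prems[of x y] insert.hyps(2) that by auto
  have "sorted_wrt r ?qs"
    unfolding sorted_wrt_append using ps after trans by (auto simp: sorted_wrt_filter)
  moreover have "set ?qs = insert x C" using ps(2) by auto
  ultimately show ?case by blast
qed simp

lemma strictly_refines_trans:
  "strictly_refines n P Q \<Longrightarrow> strictly_refines n Q R \<Longrightarrow> strictly_refines n P R"
  unfolding strictly_refines_def using refines_trans refines_asym by blast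

lemma strictly_refines_asym: "strictly_refines n P Q \<Longrightarrow> \<not> strictly_refines n Q P"
  unfolding strictly_refines_def using refines_asym by blast

section \<open>The number of blocks as a rank\<close>

lemma card_refines_mono:
  assumes "refines S P Q" "finite P"
  shows "card Q \<le> card P"
proof -
  have P: "partition_on S P" and Q: "partition_on S Q" and le: "\<forall>A\<in>P. \<exists>B\<in>Q. A \<subseteq> B"
    using assms(1) unfolding refines_def by auto
  have "Q \<subseteq> (\<lambda>A. SOME B. B \<in> Q \<and> A \<subseteq> B) ` P"
  proof
    fix B assume B: "B \<in> Q"
    then obtain x where x: "x \<in> B" "x \<in> S" using partition_on_memD[OF Q B] by blast
    then obtain A where A: "A \<in> P" "x \<in> A" using partition_on_obtain[OF P] by blast
    have "\<exists>B. B \<in> Q \<and> A \<subseteq> B" using le A by blast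
    from someI_ex[OF this] have "(SOME B. B \<in> Q \<and> A \<subseteq> B) = B"
      using partition_on_block_eq[OF Q _ B] A x by blast
    then show "B \<in> (\<lambda>A. SOME B. B \<in> Q \<and> A \<subseteq> B) ` P" using A by blast
  qed
  then show ?thesis using assms(2) by (rule surj_card_le[rotated])
qed

text \<open>Otherwise some split of \<open>Q\<close> would still be refined by \<open>P\<close> and
  have \<open>d\<close> more blocks than \<open>P\<close>.\<close>

lemma refines_eq_if_card_eq:
  assumes "P \<in> ND d S" "Q \<in> ND d S" "finite S" "1 \<le> d" "refines S P Q" "card P = card Q"
  shows "P = Q"
proof (rule ccontr)
  assume "P \<noteq> Q"
  then obtain R where R: "split_step d R Q" "refines S P R"
    using exists_split_step[OF assms(1-3,5)] by blast
  have "finite P" using NDD(1)[OF assms(1)] assms(3) finite_elements by blast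
  then have "card R \<le> card P" using card_refines_mono R(2) by blast
  then show False using split_stepD(3)[OF R(1) assms(2,3)] assms(4,6) by simp
qed

text \<open>Every block contributes 1 modulo \<open>d\<close>. So block counts take no values other
  than those met along a full split chain.\<close>

lemma card_ND_cong:
  assumes P: "P \<in> ND d S" and fin: "finite S"
  shows "[card S = card P] (mod d)"
proof -
  have "card S = (\<Sum>B\<in>P. card B)"
    using card_Union_disjoint[of P] partition_onD1[OF NDD(1)[OF P]] partition_onD2[OF NDD(1)[OF P]]
      ND_memD(2)[OF P] fin finite_subset by (metis disjoint_def disjnt_def pairwiseI)
  moreover have "[(\<Sum>B\<in>P. card B) = (\<Sum>B\<in>P. 1)] (mod d)"
    using ND_memD(1)[OF P] unfolding good_def by (intro cong_sum) blast
  ultimately show ?thesis by simp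
qed

lemma split_chain_card:
  assumes fin: "finite S" and "split_chain d S ps"
  shows "i < length ps \<Longrightarrow> card (ps ! i) + d * i = card S"
  using assms(2)
proof (induction arbitrary: i rule: split_chain.induct)
  case base
  then show ?case by (simp add: card_image)
next
  case (snoc ps P)
  show ?case
  proof (cases "i < length ps")
    case True
    then show ?thesis using snoc.IH by (simp add: nth_append)
  next
    case False
    then have i: "i = length ps" using snoc.prems by simp
    have ne: "ps \<noteq> []" using split_chain_nonempty snoc.hyps by blast
    have "card (last ps) + d * (length ps - 1) = card S"
      using snoc.IH[of "length ps - 1"] ne by (simp add: last_conv_nth)
    moreover have "card (last ps) = card P + d" using split_stepD(3) snoc.hyps fin by blast
    moreover have "d + d * (length ps - 1) = d * length ps"
      using ne by (metis length_greater_0_conv mult_Suc_right Suc_diff_1)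
    ultimately show ?thesis using i by simp
  qed
qed

lemma split_chain_sorted:
  assumes d: "1 \<le> d" and "split_chain d {1..n} ps"
  shows "sorted_wrt (strictly_refines n) ps \<and> (\<forall>Q\<in>set ps. refines {1..n} Q (last ps))"
  using assms(2)
proof (induction rule: split_chain.induct)
  case base
  then show ?case by (simp add: refines_refl partition_on_singletons)
next
  case (snoc ps P)
  note step = split_stepD[OF snoc.hyps(3,2)]
  have "last ps \<noteq> P" using step(3) d by auto
  then have "strictly_refines n (last ps) P" unfolding strictly_refines_def using step(2) by simp
  moreover have "Q = last ps \<or> strictly_refines n Q (last ps)" if "Q \<in> set ps" for Q
    using snoc.IH that unfolding strictly_refines_def by blast
  ultimately have less: "\<forall>Q\<in>set ps. strictly_refines n Q P" using strictly_refines_trans by blast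
  moreover have "refines {1..n} P P" using refines_refl NDD(1)[OF snoc.hyps(2)] by blast
  ultimately show ?case using snoc.IH unfolding sorted_wrt_append strictly_refines_def by auto
qed

lemma chain_list_eqI:
  assumes "sorted_wrt (strictly_refines n) ps"
  shows "chain_list n (set ps) = ps"
  unfolding chain_list_def
  using assms sorted_wrt_unique[of "strictly_refines n"] strictly_refines_asym
  by (intro the_equality) blast+

lemma maxchain_memI:
  assumes C: "pred_on.maxchain A r C" and R: "R \<in> A" "\<And>P. P \<in> C \<Longrightarrow> P = R \<or> r P R \<or> r R P"
  shows "R \<in> C"
proof (rule ccontr)
  assume "R \<notin> C"
  have ch: "pred_on.chain A r C" and max: "\<not> (\<exists>D. pred_on.chain A r D \<and> C \<subset> D)"
    using C unfolding pred_on.maxchain_def by auto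
  have "pred_on.chain A r (insert R C)"
    using ch R unfolding pred_on.chain_def by auto
  then show False using max \<open>R \<notin> C\<close> by blast
qed

lemma singletons_refines:
  assumes P: "partition_on S P"
  shows "refines S ((\<lambda>x. {x}) ` S) P"
  unfolding refines_def
proof (intro conjI ballI)
  fix A assume "A \<in> (\<lambda>x. {x}) ` S"
  then obtain x where x: "x \<in> S" "A = {x}" by blast
  then show "\<exists>B\<in>P. A \<subseteq> B" using partition_on_obtain[OF P x(1)] by blast
qed (simp_all add: partition_on_singletons P)

lemma refines_one_block:
  assumes "partition_on S P" "S \<noteq> {}"
  shows "refines S P {S}"
  unfolding refines_def
  using assms(1) partition_on_space[OF assms(2)] partition_on_memD[OF assms(1)] by simp

lemma split_chain_if_nth:
  assumes "ps \<noteq> []" "set ps \<subseteq> ND d S" "ps ! 0 = (\<lambda>x. {x}) ` S"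
    and step: "\<And>i. Suc i < length ps \<Longrightarrow> split_step d (ps ! i) (ps ! Suc i)"
  shows "split_chain d S ps"
proof -
  have "m < length ps \<Longrightarrow> split_chain d S (take (Suc m) ps)" for m
  proof (induction m)
    case 0
    then show ?case using assms(3) split_chain.base by (simp add: take_Suc_conv_app_nth)
  next
    case (Suc m)
    have "last (take (Suc m) ps) = ps ! m" using Suc.prems by (simp add: take_Suc_conv_app_nth)
    moreover have "ps ! Suc m \<in> ND d S" using Suc.prems assms(2) nth_mem by blast
    ultimately have "split_chain d S (take (Suc m) ps @ [ps ! Suc m])"
      using Suc step by (intro split_chain.snoc) auto
    then show ?case using Suc.prems by (simp add: take_Suc_conv_app_nth)
  qed
  from this[of "length ps - 1"] show ?thesis using assms(1) by simp
qed

lemma good_interval: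
  assumes "[n = 1] (mod d)"
  shows "good d {1..n}"
proof -
  have "[y = x + card ({1..n} \<inter> {x..<y})] (mod d)" if "x \<in> {1..n}" "y \<in> {1..n}" "x \<le> y" for x y
  proof -
    have "{1..n} \<inter> {x..<y} = {x..<y}" using that by auto
    then show ?thesis using that by simp
  qed
  then show ?thesis unfolding good_def using assms by simp
qed

lemma one_block_in_ND:
  assumes "[n = 1] (mod d)" "1 \<le> n"
  shows "{{1..n}} \<in> ND d {1..n}"
  unfolding ND_def noncrossing_def using good_interval[OF assms(1)] assms(2)
  by (auto intro: partition_on_space)

text \<open>A further partition comparable with all members has the same number of blocks as one of
  them, and comparable partitions of equal rank coincide.\<close>

lemma split_chain_maxchain:
  assumes d: "1 \<le> d" and n: "n = d * k + 1" and ps: "split_chain d {1..n} ps" "last ps = {{1..n}}"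
  shows "pred_on.maxchain (ND d {1..n}) (strictly_refines n) (set ps)"
  unfolding pred_on.maxchain_def
proof
  have sorted: "sorted_wrt (strictly_refines n) ps" using split_chain_sorted[OF d ps(1)] by blast
  show "pred_on.chain (ND d {1..n}) (strictly_refines n) (set ps)"
    unfolding pred_on.chain_def
  proof (intro conjI ballI)
    show "set ps \<subseteq> ND d {1..n}" by (rule split_chain_subset_ND[OF ps(1)])
    fix P Q assume "P \<in> set ps" "Q \<in> set ps"
    then obtain i j where "i < length ps" "P = ps ! i" "j < length ps" "Q = ps ! j"
      by (metis in_set_conv_nth)
    then show "(strictly_refines n)\<^sup>=\<^sup>= P Q \<or> (strictly_refines n)\<^sup>=\<^sup>= Q P"
      using sorted_wrt_nth_less[OF sorted, of i j] sorted_wrt_nth_less[OF sorted, of j i]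
      by (cases i j rule: linorder_cases) auto
  qed
  have ne: "ps \<noteq> []" using split_chain_nonempty ps(1) by blast
  have card: "card (ps ! i) + d * i = n" if "i < length ps" for i
    using split_chain_card[OF _ ps(1) that] by simp
  have "card (ps ! (length ps - 1)) = 1" using ps(2) ne by (simp add: last_conv_nth)
  then have "d * (length ps - 1) = d * k" using card[of "length ps - 1"] ne n by simp
  then have "length ps - 1 = k" using d by simp
  then have len: "length ps = Suc k" using ne by (metis Suc_diff_1 length_greater_0_conv)
  show "\<nexists>D. pred_on.chain (ND d {1..n}) (strictly_refines n) D \<and> set ps \<subset> D"
  proof
    assume "\<exists>D. pred_on.chain (ND d {1..n}) (strictly_refines n) D \<and> set ps \<subset> D"
    then obtain D R where D: "pred_on.chain (ND d {1..n}) (strictly_refines n) D"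
      "set ps \<subseteq> D" "R \<in> D" "R \<notin> set ps" by blast
    have R: "R \<in> ND d {1..n}" using D unfolding pred_on.chain_def by blast
    have part: "partition_on {1..n} R" using NDD(1)[OF R] .
    have "refines {1..n} ((\<lambda>x. {x}) ` {1..n}) R" using singletons_refines[OF part] .
    then have "card R \<le> n" using card_refines_mono by (fastforce simp: card_image)
    moreover have "[d * k + 1 = 0 + 1] (mod d)" by (intro cong_add) (simp_all add: cong_0_iff)
    then have "[card R = 1] (mod d)"
      using card_ND_cong[OF R] cong_trans[of "card R" n d 1] n by (simp add: cong_sym)
    moreover have "card R \<noteq> 0"
      using finite_elements[OF _ part] partition_onD1[OF part] n by auto
    ultimately have "d dvd card R - 1" "card R - 1 + 1 = card R" "card R \<le> n"
      by (simp_all add: cong_altdef_nat)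
    then obtain j where j: "card R = d * j + 1" by (metis dvdE)
    then have "d * j \<le> d * k" using \<open>card R \<le> n\<close> n by simp
    then have jk: "j \<le> k" using d by simp
    \<comment> \<open>The bottom has \<open>d * k + 1\<close> blocks and every step up removes
      \<open>d\<close>, so index \<open>k - j\<close> is the level with \<open>d * j + 1\<close>
      blocks.\<close>
    have i: "k - j < length ps" using len by simp
    have "d * j + d * (k - j) = d * k" using jk by (metis add_mult_distrib2 le_add_diff_inverse)
    then have eq: "card (ps ! (k - j)) = card R" using card[OF i] j n by simp
    have mem: "ps ! (k - j) \<in> set ps" "ps ! (k - j) \<in> ND d {1..n}"
      using i nth_mem split_chain_subset_ND[OF ps(1)] by blast+
    then have "refines {1..n} R (ps ! (k - j)) \<or> refines {1..n} (ps ! (k - j)) R"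
      using D unfolding pred_on.chain_def strictly_refines_def by (auto intro: refines_refl part)
    then have "R = ps ! (k - j)"
      using refines_eq_if_card_eq[OF R mem(2) _ d] refines_eq_if_card_eq[OF mem(2) R _ d] eq by auto
    then show False using D(4) mem(1) by blast
  qed
qed

text \<open>Between consecutive members there is a split of the upper one that the lower one
  refines. It is comparable with the whole chain, so maximality puts it into the chain, where only
  the lower member is left for it.\<close>

lemma maxchain_split_chain:
  assumes d: "1 \<le> d" and n: "[n = 1] (mod d)" "1 \<le> n"
    and C: "pred_on.maxchain (ND d {1..n}) (strictly_refines n) C"
  obtains ps where "split_chain d {1..n} ps" "last ps = {{1..n}}" "set ps = C"
proof -
  let ?r = "strictly_refines n" and ?S = "{1..n}"
  have sub: "C \<subseteq> ND d ?S" and total: "\<And>P Q. P \<in> C \<Longrightarrow> Q \<in> C \<Longrightarrow> P = Q \<or> ?r P Q \<or> ?r Q P"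
    using C unfolding pred_on.maxchain_def pred_on.chain_def by auto
  have "ND d ?S \<subseteq> Pow (Pow ?S)" using ND_memD(2) by blast
  then have "finite C" using sub finite_subset by (meson finite_Pow_iff finite_atLeastAtMost)
  then obtain ps where ps: "sorted_wrt ?r ps" "set ps = C"
    using finite_total_sorted_list[of ?r C] strictly_refines_trans total by metis
  have less: "?r (ps ! i) (ps ! j)" if "i < j" "j < length ps" for i j
    using sorted_wrt_nth_less[OF ps(1) that] .
  have inC: "ps ! i \<in> C" "ps ! i \<in> ND d ?S" if "i < length ps" for i
    using that nth_mem ps(2) sub by blast+
  have part: "partition_on ?S P" if "P \<in> ND d ?S" for P using NDD(1)[OF that] .
  have bot: "(\<lambda>x. {x}) ` ?S \<in> C"
  proof (rule maxchain_memI[OF C singletons_in_ND])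
    fix P assume "P \<in> C"
    then show "P = (\<lambda>x. {x}) ` ?S \<or> ?r P ((\<lambda>x. {x}) ` ?S) \<or> ?r ((\<lambda>x. {x}) ` ?S) P"
      using singletons_refines[OF part] sub unfolding strictly_refines_def by blast
  qed
  have top: "{?S} \<in> C"
  proof (rule maxchain_memI[OF C one_block_in_ND[OF n]])
    fix P assume "P \<in> C"
    then show "P = {?S} \<or> ?r P {?S} \<or> ?r {?S} P"
      using refines_one_block[OF part] sub n(2) unfolding strictly_refines_def by auto
  qed
  have ne: "ps \<noteq> []" using bot ps(2) by auto
  have first: "ps ! 0 = (\<lambda>x. {x}) ` ?S"
  proof -
    obtain j where j: "j < length ps" "ps ! j = (\<lambda>x. {x}) ` ?S" using bot ps(2) by (metis in_set_conv_nth)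
    have "\<not> 0 < j"
    proof
      assume "0 < j"
      then have "?r (ps ! 0) (ps ! j)" using less j by blast
      moreover have "refines ?S (ps ! j) (ps ! 0)"
        using singletons_refines[OF part[OF inC(2)[of 0]]] j ne by simp
      ultimately show False unfolding strictly_refines_def using refines_asym by blast
    qed
    then show ?thesis using j by simp
  qed
  have last: "last ps = {?S}"
  proof -
    obtain j where j: "j < length ps" "ps ! j = {?S}" using top ps(2) by (metis in_set_conv_nth)
    have "\<not> j < length ps - 1"
    proof
      assume "j < length ps - 1"
      then have "?r (ps ! j) (ps ! (length ps - 1))" using less by simp
      moreover have "refines ?S (ps ! (length ps - 1)) (ps ! j)"
        using refines_one_block[OF part[OF inC(2)]] j n(2) by auto
      ultimately show False unfolding strictly_refines_def using refines_asym by blast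
    qed
    then have "j = length ps - 1" using j by simp
    then show ?thesis using j ne by (simp add: last_conv_nth)
  qed
  have "split_step d (ps ! i) (ps ! Suc i)" if i: "Suc i < length ps" for i
  proof -
    have ri: "refines ?S (ps ! i) (ps ! Suc i)" "ps ! i \<noteq> ps ! Suc i"
      using less[of i "Suc i"] i unfolding strictly_refines_def by auto
    obtain R where R: "split_step d R (ps ! Suc i)" "refines ?S (ps ! i) R"
      using exists_split_step[OF inC(2) inC(2) _ ri] i by auto
    note R' = split_stepD[OF R(1) inC(2)[OF i] finite_atLeastAtMost]
    have Rne: "R \<noteq> ps ! Suc i" using R'(3) d by auto
    have below: "refines ?S (ps ! j) R" if "j \<le> i" for j
      using less[of j i] i R(2) refines_trans that unfolding strictly_refines_def
      by (cases "j = i") auto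
    have above: "refines ?S R (ps ! j)" if "Suc i \<le> j" "j < length ps" for j
      using less[of "Suc i" j] R'(2) refines_trans that unfolding strictly_refines_def
      by (cases "j = Suc i") auto
    have "R \<in> C"
    proof (rule maxchain_memI[OF C R'(1)])
      fix P assume "P \<in> C"
      then obtain j where "j < length ps" "P = ps ! j" using ps(2) by (metis in_set_conv_nth)
      then show "P = R \<or> ?r P R \<or> ?r R P"
        using below[of j] above[of j] unfolding strictly_refines_def by (cases "j \<le> i") auto
    qed
    then obtain j where j: "j < length ps" "R = ps ! j" using ps(2) by (metis in_set_conv_nth)
    have "j \<le> i"
    proof (rule ccontr)
      assume "\<not> j \<le> i"
      then have "refines ?S (ps ! Suc i) R"
        using less[of "Suc i" j] j NDD(1)[OF R'(1)] refines_refl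
        unfolding strictly_refines_def by (cases "j = Suc i") auto
      then show False using R'(2) Rne refines_asym by blast
    qed
    then have "refines ?S R (ps ! i)"
      using less[of j i] j i NDD(1)[OF R'(1)] refines_refl
      unfolding strictly_refines_def by (cases "j = i") auto
    then show ?thesis using R refines_asym by blast
  qed
  then have "split_chain d ?S ps"
    using split_chain_if_nth[OF ne _ first] ps(2) sub by blast
  then show ?thesis using that last ps(2) by blast
qed

theorem theorem7p1:
  fixes d k :: nat
  assumes "d \<ge> 1"
  shows "bij_betw (chain_labels (d * k + 1)) (maximal_chains d (d * k + 1)) (parking_functions d k)"
proof -
  define n where "n = d * k + 1"
  have "[d * k + 1 = 0 + 1] (mod d)" by (intro cong_add) (simp_all add: cong_0_iff)
  then have n: "[n = 1] (mod d)" "1 \<le> n" unfolding n_def by simp_all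
  let ?T = "{ps. split_chain d {1..n} ps \<and> last ps = {{1..n}}}"
  \<comment> \<open>Chains are sets while labels are read off lists; sortedness by strict refinement
    makes the list recoverable from its set, so uniqueness of lists gives injectivity on
    sets.\<close>
  have chains: "maximal_chains d n = set ` ?T"
    unfolding maximal_chains_def NC_eq_ND[OF n(1)]
  proof (intro equalityI subsetI)
    fix C assume "C \<in> {C. pred_on.maxchain (ND d {1..n}) (strictly_refines n) C}"
    then obtain ps where "split_chain d {1..n} ps" "last ps = {{1..n}}" "set ps = C"
      using maxchain_split_chain[OF assms n] by blast
    then show "C \<in> set ` ?T" by blast
  next
    fix C assume "C \<in> set ` ?T"
    then obtain ps where "split_chain d {1..n} ps" "last ps = {{1..n}}" "C = set ps" by blast
    then show "C \<in> {C. pred_on.maxchain (ND d {1..n}) (strictly_refines n) C}"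
      using split_chain_maxchain[OF assms n_def] by simp
  qed
  have list: "chain_labels n (set ps) = labels ps" if "ps \<in> ?T" for ps
    using chain_list_eqI split_chain_sorted[OF assms] that
    unfolding chain_labels_def labels_def by simp
  have ex1: "\<exists>!ps. ps \<in> ?T \<and> labels ps = as" if "as \<in> parking_functions d k" for as
    using ex1_split_chain[OF _ assms one_block_in_ND[OF n], of as]
      parking_functions_iff_parked[OF assms, of as k] that unfolding n_def by auto
  have range: "labels ps \<in> parking_functions d k" if "ps \<in> ?T" for ps
    using split_chain_labels[OF _ assms, of "{1..n}" ps]
      parking_functions_iff_parked[OF assms, of "labels ps" k] that unfolding n_def by auto
  have "bij_betw (chain_labels n) (maximal_chains d n) (parking_functions d k)"
    unfolding bij_betw_def chains
  proof
    show "inj_on (chain_labels n) (set ` ?T)"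
    proof (rule inj_onI)
      fix C D assume "C \<in> set ` ?T" "D \<in> set ` ?T" and eq: "chain_labels n C = chain_labels n D"
      then obtain ps qs where psqs: "ps \<in> ?T" "C = set ps" "qs \<in> ?T" "D = set qs" by blast
      then have "labels qs = labels ps" using eq list by simp
      then have "ps = qs"
        using the1_equality[OF ex1[OF range[OF psqs(1)]], of ps]
          the1_equality[OF ex1[OF range[OF psqs(1)]], of qs] psqs by simp
      then show "C = D" using psqs by simp
    qed
    show "chain_labels n ` (set ` ?T) = parking_functions d k"
    proof (intro equalityI subsetI)
      fix as assume "as \<in> parking_functions d k"
      from ex1_implies_ex[OF ex1[OF this]] obtain ps where ps: "ps \<in> ?T" "labels ps = as"
        by (elim exE conjE)
      then have "as = chain_labels n (set ps)" using list[OF ps(1)] by simp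
      then show "as \<in> chain_labels n ` (set ` ?T)" using ps(1) by (intro image_eqI[of as _ "set ps"] imageI)
    qed (use range list in auto)
  qed
  then show ?thesis unfolding n_def .
qed

end
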